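(* Let $f\in C(I,I)$ with $h(f)=0$. Then $f$ has no $3$-scrambled tuple.
   Context: $I=[0,1]$, $C(I,I)$ continuous self-maps of $I$, $h(f)$ topological entropy. For $n\ge2$, a tuple $\langle x_1,\dots,x_n\rangle\in I^n$ is $n$-scrambled if $\liminf_{k\to\infty}\max_{1\le i<j\le n}|f^k(x_i)-f^k(x_j)|=0$ and $\limsup_{k\to\infty}\min_{1\le i<j\le n}|f^k(x_i)-f^k(x_j)|>0$. *)

theory Defs
  imports "HOL-Analysis.Analysis" "HOL-Library.Extended_Real"
begin

definition interval_map :: "(real \<Rightarrow> real) \<Rightarrow> bool" where
  "interval_map f \<longleftrightarrow> continuous_on {0..1} f \<and> f ` {0..1} \<subseteq> {0..1}"

definition separated_set :: "(real \<Rightarrow> real) \<Rightarrow> nat \<Rightarrow> real \<Rightarrow> real set \<Rightarrow> bool" where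
  "separated_set f n \<epsilon> E \<longleftrightarrow> E \<subseteq> {0..1} \<and> finite E \<and>
     (\<forall>x\<in>E. \<forall>y\<in>E. x \<noteq> y \<longrightarrow> (\<exists>k<n. \<bar>(f^^k) x - (f^^k) y\<bar> > \<epsilon>))"

definition sep_num :: "(real \<Rightarrow> real) \<Rightarrow> nat \<Rightarrow> real \<Rightarrow> nat" where
  "sep_num f n \<epsilon> = Sup {card E | E. separated_set f n \<epsilon> E}"

text \<open>Topological entropy h(f) = lim_{eps->0} limsup_n (1/n) log s(n,eps);
  the inner quantity is monotone in eps, so the limit is the supremum over eps > 0.\<close>
definition topological_entropy :: "(real \<Rightarrow> real) \<Rightarrow> ereal" where
  "topological_entropy f =
     (SUP \<epsilon>\<in>{0<..}. limsup (\<lambda>n. ereal (ln (real (sep_num f n \<epsilon>)) / real n)))"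

definition scrambled :: "(real \<Rightarrow> real) \<Rightarrow> nat \<Rightarrow> (nat \<Rightarrow> real) \<Rightarrow> bool" where
  "scrambled f n x \<longleftrightarrow> (\<forall>i<n. x i \<in> {0..1}) \<and>
     liminf (\<lambda>k. ereal (Max {\<bar>(f^^k) (x i) - (f^^k) (x j)\<bar> | i j. i < j \<and> j < n})) = 0 \<and>
     limsup (\<lambda>k. ereal (Min {\<bar>(f^^k) (x i) - (f^^k) (x j)\<bar> | i j. i < j \<and> j < n})) > 0"

end

theory Submission
  imports Defs
begin

text \<open>
  A horseshoe of an iterate forces positive entropy, so no iterate of \<open>f\<close> has one. Hence, for a fixed
  point \<open>z\<close> of an iterate \<open>g\<close> and two points of one limit set lying on the same side of \<open>z\<close>, no point
  between the two is eventually mapped to \<open>z\<close>. It follows that a limit set containing a fixed point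
  is that point, and that two orbits whose limit sets share a point end up moving in step between the
  two sides of \<open>z\<close>.

  Let a triple of orbits accumulate at \<open>(a, b, c)\<close>, \<open>a < b < c\<close>, and at \<open>(p, p, p)\<close>. For \<open>g = f\<^sup>r\<close> with
  \<open>r\<close> a return time of the middle orbit to \<open>(a, c)\<close>, some \<open>q\<close> in \<open>(a, c)\<close> is eventually mapped to a fixed
  point \<open>z\<close> (otherwise orbits through \<open>(a, c)\<close> are monotone and \<open>b\<close> is fixed). By synchronisation \<open>z\<close>
  lies outside \<open>[a, c]\<close>, and one of \<open>p\<close>, \<open>g p\<close> lies on the same side of \<open>z\<close> as \<open>a\<close> and \<open>c\<close>; it is in the
  limit sets of both outer orbits, and together with \<open>a\<close> or \<open>c\<close> it encloses \<open>q\<close>.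
\<close>

section \<open>Cluster points of sequences\<close>

text \<open>Stated for metric spaces because it serves both single orbits on the line and joint
  orbits of three points in a product.\<close>

definition cluster :: "(nat \<Rightarrow> 'a::metric_space) \<Rightarrow> 'a \<Rightarrow> bool" where
  "cluster X l \<longleftrightarrow> (\<forall>e>0. \<exists>\<^sub>F n in sequentially. dist (X n) l < e)"

lemma cluster_frequently:
  assumes "cluster X l" "open U" "l \<in> U"
  shows "\<exists>\<^sub>F n in sequentially. X n \<in> U"
proof -
  obtain e where e: "e > 0" "\<And>y. dist y l < e \<Longrightarrow> y \<in> U"
    using assms(2,3) unfolding open_dist by blast
  have "\<exists>\<^sub>F n in sequentially. dist (X n) l < e"
    using assms(1) e(1) by (auto simp: cluster_def)
  then show ?thesis by (rule frequently_elim1) (use e in auto)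
qed

lemma cluster_map:
  assumes "cluster X l" "isCont h l"
  shows "cluster (\<lambda>n. h (X n)) (h l)"
  unfolding cluster_def
proof (intro allI impI)
  fix e :: real assume "e > 0"
  then obtain d where d: "d > 0" "\<And>y. dist y l < d \<Longrightarrow> dist (h y) (h l) < e"
    using assms(2) unfolding continuous_at_eps_delta by blast
  have "\<exists>\<^sub>F n in sequentially. dist (X n) l < d"
    using assms(1) d(1) by (auto simp: cluster_def)
  then show "\<exists>\<^sub>F n in sequentially. dist (h (X n)) (h l) < e"
    by (rule frequently_elim1) (use d in auto)
qed

lemma cluster_subsequence:
  assumes "strict_mono s" "cluster (\<lambda>n. X (s n)) l"
  shows "cluster X l"
  unfolding cluster_def frequently_sequentially
proof (intro allI impI)
  fix e :: real and N :: nat assume "e > 0"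
  then obtain n where "n \<ge> N" "dist (X (s n)) l < e"
    using assms(2) unfolding cluster_def frequently_sequentially by blast
  moreover have "s n \<ge> n" using assms(1) by (rule seq_suble)
  ultimately show "\<exists>n\<ge>N. dist (X n) l < e" by (meson order_trans)
qed

lemma tendsto_imp_cluster:
  assumes "X \<longlonglongrightarrow> l" shows "cluster X l"
  unfolding cluster_def
  using assms by (auto simp: tendsto_iff intro!: eventually_frequently)

lemma tendsto_cluster_unique:
  assumes "X \<longlonglongrightarrow> l" "cluster X m" shows "m = l"
proof (rule ccontr)
  assume "m \<noteq> l"
  then have e: "dist m l / 2 > 0" by simp
  have "\<exists>\<^sub>F n in sequentially. dist (X n) m < dist m l / 2"
    using assms(2) e unfolding cluster_def by blast
  moreover have "\<forall>\<^sub>F n in sequentially. dist (X n) l < dist m l / 2"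
    using assms(1) e by (rule tendstoD)
  ultimately have "\<exists>\<^sub>F n in sequentially. dist (X n) m < dist m l / 2 \<and> dist (X n) l < dist m l / 2"
    by (rule frequently_eventually_frequently)
  then obtain n where "dist (X n) m < dist m l / 2" "dist (X n) l < dist m l / 2"
    using frequently_ex by blast
  then show False by (metis dist_triangle_half_r dist_commute less_irrefl)
qed

lemma frequently_compact_cluster:
  assumes "compact C" "\<exists>\<^sub>F n in sequentially. X n \<in> C"
  shows "\<exists>l\<in>C. cluster X l"
proof -
  have inf: "infinite {n. X n \<in> C}"
    using assms(2) by (simp add: frequently_cofinite flip: cofinite_eq_sequentially)
  define r where "r = enumerate {n. X n \<in> C}"
  have r: "strict_mono r" unfolding r_def by (rule strict_mono_enumerate[OF inf])
  have "\<forall>n. (X \<circ> r) n \<in> C"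
    using enumerate_in_set[OF inf] by (auto simp: r_def)
  with assms(1) obtain l s where ls: "l \<in> C" "strict_mono s" "((X \<circ> r) \<circ> s) \<longlonglongrightarrow> l"
    unfolding compact_def by meson
  have "cluster (\<lambda>n. X ((r \<circ> s) n)) l"
    using tendsto_imp_cluster[OF ls(3)] by (simp add: o_def)
  then have "cluster X l"
    by (rule cluster_subsequence[OF strict_mono_o[OF r ls(2)]])
  with ls show ?thesis by blast
qed

lemma closed_cluster: "closed {l. cluster X l}"
  unfolding closed_sequential_limits
proof (intro allI impI, elim conjE)
  fix v l assume v: "\<forall>n. v n \<in> {l. cluster X l}" and lim: "v \<longlonglongrightarrow> l"
  show "l \<in> {l. cluster X l}"
    unfolding mem_Collect_eq cluster_def
  proof (intro allI impI)
    fix e :: real assume "e > 0"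
    then have e: "e / 2 > 0" by simp
    then obtain k where k: "dist (v k) l < e / 2"
      using eventually_happens'[OF sequentially_bot tendstoD[OF lim e]] by blast
    have "\<exists>\<^sub>F n in sequentially. dist (X n) (v k) < e / 2"
      using v e unfolding cluster_def by blast
    then show "\<exists>\<^sub>F n in sequentially. dist (X n) l < e"
      by (rule frequently_elim1) (use k in \<open>metis dist_commute dist_triangle_half_l\<close>)
  qed
qed

lemma cluster_shift: "cluster (\<lambda>n. X (n + k)) l \<longleftrightarrow> cluster X l"
proof -
  have "(\<exists>\<^sub>F n in sequentially. P (n + k)) \<longleftrightarrow> (\<exists>\<^sub>F n in sequentially. P n)" for P :: "nat \<Rightarrow> bool"
    using eventually_sequentially_seg[of "\<lambda>n. \<not> P n" k] by (simp add: frequently_def)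
  from this[of "\<lambda>n. dist (X n) l < _"] show ?thesis by (simp add: cluster_def)
qed

text \<open>There are finitely many residue classes: if each of them eventually keeps a positive
  distance from \<open>l\<close>, the least of these distances keeps the whole sequence away from
  \<open>l\<close>.\<close>

lemma cluster_residue:
  assumes "cluster X l" "r > 0"
  shows "\<exists>s<r. cluster (\<lambda>n. X (s + r * n)) l"
proof (rule ccontr)
  assume "\<not> ?thesis"
  then have "\<forall>s<r. \<exists>e>0. \<forall>\<^sub>F n in sequentially. \<not> dist (X (s + r * n)) l < e"
    by (auto simp: cluster_def frequently_def)
  then obtain e where e: "\<And>s. s < r \<Longrightarrow> e s > 0"
      "\<And>s. s < r \<Longrightarrow> \<forall>\<^sub>F n in sequentially. \<not> dist (X (s + r * n)) l < e s"
    by metis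
  define d where "d = Min (e ` {..<r})"
  have "d \<in> e ` {..<r}" unfolding d_def using assms(2) by (intro Min_in) auto
  then have d: "d > 0" "\<And>s. s < r \<Longrightarrow> d \<le> e s"
    using e(1) by (auto simp: d_def)
  have "\<forall>\<^sub>F n in sequentially. \<forall>s\<in>{..<r}. \<not> dist (X (s + r * n)) l < e s"
    using e(2) by (intro eventually_ball_finite) auto
  then obtain N where N: "\<And>n s. n \<ge> N \<Longrightarrow> s < r \<Longrightarrow> \<not> dist (X (s + r * n)) l < e s"
    unfolding eventually_sequentially by auto
  obtain n where n: "n \<ge> r * N" "dist (X n) l < d"
    using assms(1) d(1) unfolding cluster_def frequently_sequentially by blast
  have "n div r \<ge> N" using n(1) assms(2) by (simp add: less_eq_div_iff_mult_less_eq mult.commute)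
  moreover have "n mod r < r" using assms(2) by simp
  ultimately have "\<not> dist (X (n mod r + r * (n div r))) l < e (n mod r)" by (rule N)
  with n(2) d(2)[OF \<open>n mod r < r\<close>] show False by simp
qed

section \<open>Horseshoes\<close>

text \<open>Leaving the exponent \<open>m\<close> free lets the absence of horseshoes pass to every
  positive power of \<open>f\<close>. The strict gap \<open>b < c\<close> later provides the
  separation scale in the entropy estimate.\<close>

definition horseshoe :: "(real \<Rightarrow> real) \<Rightarrow> bool" where
  "horseshoe f \<longleftrightarrow> (\<exists>m>0. \<exists>a b c d. a \<le> b \<and> b < c \<and> c \<le> d \<and>
     {a..d} \<subseteq> (f ^^ m) ` {a..b} \<and> {a..d} \<subseteq> (f ^^ m) ` {c..d})"

lemma horseshoeI:
  assumes "m > 0" "a \<le> b" "b < c" "c \<le> d"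
    and "{a..d} \<subseteq> (f ^^ m) ` {a..b}" "{a..d} \<subseteq> (f ^^ m) ` {c..d}"
  shows "horseshoe f"
  using assms unfolding horseshoe_def by blast

section \<open>Limit sets, and horseshoes under reflection and powers\<close>

definition omega_limit :: "(real \<Rightarrow> real) \<Rightarrow> real \<Rightarrow> real set" where
  "omega_limit f x = {v. cluster (\<lambda>n. (f ^^ n) x) v}"

text \<open>Conjugation by negation: it carries orbits, limit sets and horseshoes along and turns a
  one-sided argument into its mirror image.\<close>

definition reflect :: "(real \<Rightarrow> real) \<Rightarrow> real \<Rightarrow> real" where
  "reflect f t = - f (- t)"

lemma funpow_reflect: "(reflect f ^^ n) t = - (f ^^ n) (- t)"
  by (induction n) (auto simp: reflect_def)

lemma funpow_fixed: "f z = z \<Longrightarrow> (f ^^ n) z = z"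
  by (induction n) auto

lemma omega_limit_reflect:
  assumes "v \<in> omega_limit f x" shows "- v \<in> omega_limit (reflect f) (- x)"
  using cluster_map[of _ v uminus] assms
  by (auto simp: omega_limit_def funpow_reflect)

lemma omega_limit_reflect_iff: "- v \<in> omega_limit (reflect f) (- x) \<longleftrightarrow> v \<in> omega_limit f x"
proof
  have "reflect (reflect f) = f" by (rule ext) (simp add: reflect_def)
  then show "- v \<in> omega_limit (reflect f) (- x) \<Longrightarrow> v \<in> omega_limit f x"
    using omega_limit_reflect[of "-v" "reflect f" "-x"] by simp
qed (rule omega_limit_reflect)

lemma omega_limit_shift: "omega_limit f ((f ^^ k) x) = omega_limit f x"
  using cluster_shift[of "\<lambda>n. (f ^^ n) x" k]
  by (auto simp: omega_limit_def funpow_add)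

lemma horseshoe_reflect:
  assumes "horseshoe (reflect f)" shows "horseshoe f"
proof -
  obtain m a b c d where *: "m > 0" "a \<le> b" "b < c" "c \<le> d"
    "{a..d} \<subseteq> (reflect f ^^ m) ` {a..b}" "{a..d} \<subseteq> (reflect f ^^ m) ` {c..d}"
    using assms unfolding horseshoe_def by blast
  have flip: "{-d..-a} \<subseteq> (f ^^ m) ` {-t..-s}" if sub: "{a..d} \<subseteq> (reflect f ^^ m) ` {s..t}" for s t
  proof
    fix y assume "y \<in> {-d..-a}"
    then have "- y \<in> {a..d}" by auto
    then obtain u where "u \<in> {s..t}" "- y = (reflect f ^^ m) u" using sub by blast
    then show "y \<in> (f ^^ m) ` {-t..-s}"
      by (intro image_eqI[of _ _ "- u"]) (auto simp: funpow_reflect)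
  qed
  show ?thesis
    by (rule horseshoeI[OF *(1) _ _ _ flip[OF *(6)] flip[OF *(5)]]) (use * in auto)
qed

lemma horseshoe_funpow:
  assumes "horseshoe (f ^^ r)" "r > 0" shows "horseshoe f"
proof -
  obtain m a b c d where *: "m > 0" "a \<le> b" "b < c" "c \<le> d"
    "{a..d} \<subseteq> ((f ^^ r) ^^ m) ` {a..b}" "{a..d} \<subseteq> ((f ^^ r) ^^ m) ` {c..d}"
    using assms unfolding horseshoe_def by blast
  then show ?thesis
    using assms(2) by (intro horseshoeI[of "r * m" a b c d f]) (auto simp: funpow_mult mult.commute)
qed

lemma infinite_three_points:
  fixes A :: "real set"
  assumes "infinite A"
  obtains a b c where "a \<in> A" "b \<in> A" "c \<in> A" "a < b" "b < c"
proof -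
  obtain B where B: "B \<subseteq> A" "finite B" "card B = 3"
    using infinite_arbitrarily_large[OF assms] by blast
  then obtain x y z where xyz: "B = {x, y, z}" "x \<noteq> y" "y \<noteq> z" "x \<noteq> z"
    unfolding card_3_iff by auto
  have "x \<in> A" "y \<in> A" "z \<in> A" using B(1) xyz(1) by auto
  then show ?thesis using that xyz(2-4) by (metis linorder_neqE)
qed

text \<open>The orbit of a triple under the product map; its cluster points record positions that
  the three orbits approach at the same times.\<close>

definition joint :: "(real \<Rightarrow> real) \<Rightarrow> real \<Rightarrow> real \<Rightarrow> real \<Rightarrow> nat \<Rightarrow> real \<times> real \<times> real" where
  "joint f x y w n = ((f ^^ n) x, (f ^^ n) y, (f ^^ n) w)"

text \<open>A map of the whole line avoids domain conditions, and its bounded range confines every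
  orbit to a compact interval from time 1 on. The class is closed under reflection and positive
  powers.\<close>

locale no_horseshoe =
  fixes f :: "real \<Rightarrow> real" and M :: real
  assumes cont: "continuous_on UNIV f"
    and range_bounded: "\<bar>f x\<bar> \<le> M"
    and no_horseshoe: "\<not> horseshoe f"
begin

lemma no_horseshoe_reflect: "no_horseshoe (reflect f) M"
proof
  show "continuous_on UNIV (reflect f)"
    unfolding reflect_def
    by (intro continuous_intros continuous_on_compose2[OF cont]) auto
  show "\<bar>reflect f x\<bar> \<le> M" for x using range_bounded by (simp add: reflect_def)
  show "\<not> horseshoe (reflect f)" using horseshoe_reflect no_horseshoe by blast
qed

section \<open>Compactness and invariance of limit sets\<close>

lemma continuous_on_funpow: "continuous_on A (f ^^ n)"
proof (induction n)
  case (Suc n)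
  then show ?case
    by (simp add: o_def) (rule continuous_on_compose2[OF cont], auto)
qed (auto intro: continuous_intros)

lemma isCont_funpow: "isCont (f ^^ n) v"
  using continuous_on_funpow[of UNIV n] by (simp add: continuous_on_eq_continuous_at)

lemma isCont_f: "isCont f v"
  using cont by (simp add: continuous_on_eq_continuous_at)

lemma no_horseshoe_funpow: "r > 0 \<Longrightarrow> no_horseshoe (f ^^ r) M"
proof
  assume "r > 0"
  show "continuous_on UNIV (f ^^ r)" by (rule continuous_on_funpow)
  show "\<bar>(f ^^ r) x\<bar> \<le> M" for x using range_bounded \<open>r > 0\<close> by (cases r) auto
  show "\<not> horseshoe (f ^^ r)" using horseshoe_funpow no_horseshoe \<open>r > 0\<close> by blast
qed

lemma orbit_bounded: "n > 0 \<Longrightarrow> (f ^^ n) x \<in> {-M..M}"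
  using range_bounded[of "(f ^^ (n - 1)) x"] by (cases n) (auto simp: abs_le_iff)

lemma omega_limit_image: "v \<in> omega_limit f x \<Longrightarrow> f v \<in> omega_limit f x"
  using cluster_map[OF _ isCont_f, of "\<lambda>n. (f ^^ n) x" v] cluster_shift[of "\<lambda>n. (f ^^ n) x" 1]
  by (simp add: omega_limit_def)

lemma frequently_omega_limit:
  assumes "\<exists>\<^sub>F n in sequentially. (f ^^ n) x \<in> C" "closed C"
  shows "\<exists>v \<in> omega_limit f x. v \<in> C"
proof -
  have "\<forall>\<^sub>F n in sequentially. (f ^^ n) x \<in> {-M..M}"
    using orbit_bounded by (intro eventually_sequentiallyI[of 1]) (metis One_nat_def Suc_le_eq)
  with assms(1) have "\<exists>\<^sub>F n in sequentially. (f ^^ n) x \<in> C \<and> (f ^^ n) x \<in> {-M..M}"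
    by (rule frequently_eventually_frequently)
  then have "\<exists>\<^sub>F n in sequentially. (f ^^ n) x \<in> C \<inter> {-M..M}" by simp
  moreover have "compact (C \<inter> {-M..M})" using assms(2) by (intro closed_Int_compact) auto
  ultimately obtain l where "l \<in> C \<inter> {-M..M}" "cluster (\<lambda>n. (f ^^ n) x) l"
    using frequently_compact_cluster[of "C \<inter> {-M..M}" "\<lambda>n. (f ^^ n) x"] by metis
  then show ?thesis by (auto simp: omega_limit_def)
qed

lemma omega_limit_frequently:
  assumes "v \<in> omega_limit f x" "open U" "v \<in> U"
  shows "\<exists>\<^sub>F n in sequentially. (f ^^ n) x \<in> U"
  using cluster_frequently[OF _ assms(2,3)] assms(1) by (simp add: omega_limit_def)

lemma eventually_omega_limit:
  assumes "open U" "omega_limit f x \<subseteq> U"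
  shows "\<forall>\<^sub>F n in sequentially. (f ^^ n) x \<in> U"
proof (rule ccontr)
  assume "\<not> ?thesis"
  then have "\<exists>\<^sub>F n in sequentially. (f ^^ n) x \<in> - U" by (simp add: frequently_def)
  with frequently_omega_limit[of x "- U"] assms show False by (auto simp: closed_def)
qed

lemma omega_limit_subset: "omega_limit f x \<subseteq> {-M..M}"
proof
  fix w assume w: "w \<in> omega_limit f x"
  show "w \<in> {-M..M}"
  proof (rule ccontr)
    assume "w \<notin> {-M..M}"
    then have "\<exists>\<^sub>F n in sequentially. (f ^^ n) x \<in> - {-M..M}"
      using w by (intro omega_limit_frequently[of w]) auto
    then obtain n where "n \<ge> 1" "(f ^^ n) x \<in> - {-M..M}"
      unfolding frequently_sequentially by blast
    then show False using orbit_bounded[of n x] by simp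
  qed
qed

text \<open>The image of the compact limit set is closed. If \<open>v\<close> had distance at least
  \<open>d\<close> from it, late orbit points would have images farther than \<open>d / 2\<close>
  from \<open>v\<close>, yet the orbit keeps returning to within that distance.\<close>

lemma omega_limit_preimage:
  assumes "v \<in> omega_limit f x"
  obtains u where "u \<in> omega_limit f x" "f u = v"
proof -
  define K where "K = omega_limit f x"
  have "K \<subseteq> {-M..M}" unfolding K_def by (rule omega_limit_subset)
  moreover have "closed K" unfolding K_def omega_limit_def by (rule closed_cluster)
  ultimately have "compact K" by (meson bounded_closed_interval bounded_subset compact_eq_bounded_closed)
  then have "compact (f ` K)"
    using cont by (intro compact_continuous_image) (auto intro: continuous_on_subset)
  then have cl: "closed (f ` K)" by (rule compact_imp_closed)
  have "v \<in> f ` K"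
  proof (rule ccontr)
    assume v: "v \<notin> f ` K"
    have "\<exists>d>0. ball v d \<inter> f ` K = {}"
    proof -
      have "open (- (f ` K))" using cl by (simp add: open_Compl)
      then obtain d where "d > 0" "ball v d \<subseteq> - (f ` K)"
        using v by (metis ComplI open_contains_ball)
      then show ?thesis by blast
    qed
    then obtain d where d: "d > 0" "ball v d \<inter> f ` K = {}" by blast
    define U where "U = {t. dist v (f t) > d / 2}"
    have "open U" unfolding U_def
      using cont by (intro open_Collect_less continuous_intros)
    moreover have "K \<subseteq> U"
    proof
      fix w assume "w \<in> K"
      then have "f w \<notin> ball v d" using d(2) by blast
      then have "dist v (f w) \<ge> d" by simp
      then show "w \<in> U" using d(1) by (simp add: U_def)
    qed
    ultimately have "\<forall>\<^sub>F n in sequentially. (f ^^ n) x \<in> U"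
      unfolding K_def by (rule eventually_omega_limit)
    then obtain N where N: "\<And>n. n \<ge> N \<Longrightarrow> (f ^^ n) x \<in> U"
      unfolding eventually_sequentially by blast
    have "\<exists>\<^sub>F n in sequentially. (f ^^ n) x \<in> ball v (d / 2)"
      using assms d by (intro omega_limit_frequently) auto
    then obtain n where n: "n \<ge> Suc N" "(f ^^ n) x \<in> ball v (d / 2)"
      unfolding frequently_sequentially by blast
    then obtain k where "n = Suc k" "k \<ge> N" by (cases n) auto
    with n(2) N[of k] show False by (simp add: U_def)
  qed
  then show ?thesis using that unfolding K_def by blast
qed

section \<open>Homoclinic configurations\<close>

text \<open>With \<open>h = f ^^ N\<close> one has \<open>h z = z\<close>, \<open>h q = z\<close>
  and \<open>h v \<ge> q\<close>. Hence \<open>v\<close> has an \<open>h\<close>-preimage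
  \<open>v1\<close> between \<open>z\<close> and \<open>v\<close>, and another one,
  \<open>v3\<close>, between \<open>v\<close> and \<open>q\<close>. The map
  \<open>h \<circ> h\<close> sends each of \<open>[z, v1]\<close> and \<open>[v3, q]\<close> over
  \<open>[z, q]\<close>, which is a horseshoe.\<close>

lemma homoclinic_right:
  assumes z: "f z = z" and "z < v" "v < q" "(f ^^ k) q = z" "q \<le> (f ^^ N) v" "k \<le> N" "0 < N"
  shows False
proof -
  define h where "h = f ^^ N"
  have hc: "continuous_on A h" for A unfolding h_def by (rule continuous_on_funpow)
  have hz: "h z = z" unfolding h_def using z by (rule funpow_fixed)
  have "h q = (f ^^ (N - k)) ((f ^^ k) q)"
    using assms(6) unfolding h_def by (metis add.commute funpow_add le_add_diff_inverse o_apply)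
  then have hq: "h q = z" using assms(4) z by (simp add: funpow_fixed)
  have hv: "q \<le> h v" using assms(5) by (simp add: h_def)
  obtain v1 where v1: "z \<le> v1" "v1 \<le> v" "h v1 = v"
    using IVT'[of h z v v] hz hv assms hc by auto
  obtain v3 where v3: "v \<le> v3" "v3 \<le> q" "h v3 = v"
    using IVT2'[of h q v v] hq hv assms hc by auto
  have "v1 \<noteq> v" using v1 hv assms by auto
  have "continuous_on A (\<lambda>x. h (h x))" for A by (rule continuous_on_compose2[OF hc[of UNIV] hc]) auto
  then have hhc: "continuous_on A (h \<circ> h)" for A by (simp add: o_def)
  have "{z..q} \<subseteq> (h \<circ> h) ` {z..v1}"
  proof
    fix y assume "y \<in> {z..q}"
    then obtain t where "z \<le> t" "t \<le> v1" "(h \<circ> h) t = y"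
      using IVT'[of "h \<circ> h" z y v1] hz hv v1 hhc by auto
    then show "y \<in> (h \<circ> h) ` {z..v1}" by force
  qed
  moreover have "{z..q} \<subseteq> (h \<circ> h) ` {v3..q}"
  proof
    fix y assume "y \<in> {z..q}"
    then obtain t where "v3 \<le> t" "t \<le> q" "(h \<circ> h) t = y"
      using IVT2'[of "h \<circ> h" q y v3] hz hq hv v3 hhc by auto
    then show "y \<in> (h \<circ> h) ` {v3..q}" by force
  qed
  moreover have "h \<circ> h = f ^^ (N + N)" by (simp add: h_def funpow_add)
  ultimately have "horseshoe f"
    using v1 v3 \<open>v1 \<noteq> v\<close> \<open>0 < N\<close>
    by (intro horseshoeI[of "N + N" z v1 v3 q f]) auto
  then show False using no_horseshoe by blast
qed

lemma homoclinic_left: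
  assumes "f z = z" and "v < z" "q < v" "(f ^^ k) q = z" "(f ^^ N) v \<le> q" "k \<le> N" "0 < N"
  shows False
  by (rule no_horseshoe.homoclinic_right[OF no_horseshoe_reflect, of "-z" "-v" "-q" k N])
    (use assms in \<open>auto simp: funpow_reflect\<close>, simp add: reflect_def)

text \<open>The orbit of \<open>x\<close> supplies the excursion: a visit to \<open>(z, q)\<close>
  near \<open>v\<close> is followed by a visit beyond \<open>q\<close> near \<open>w\<close>, and
  the orbit point of the first visit takes the role of \<open>v\<close> in
  \<open>homoclinic_right\<close>.\<close>

lemma omega_limit_homoclinic_right:
  assumes "f z = z" "v \<in> omega_limit f x" "w \<in> omega_limit f x" "z < v" "v < q" "q < w"
    and "(f ^^ k) q = z"
  shows False
proof -
  have "\<exists>\<^sub>F n in sequentially. (f ^^ n) x \<in> {z<..<q}"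
    by (rule omega_limit_frequently[OF assms(2)]) (use assms in auto)
  then obtain n where n: "(f ^^ n) x \<in> {z<..<q}" using frequently_ex by blast
  have "\<exists>\<^sub>F n in sequentially. (f ^^ n) x \<in> {q<..}"
    by (rule omega_limit_frequently[OF assms(3)]) (use assms in auto)
  \<comment> \<open>The delay of more than \<open>k\<close> makes the travel time
    \<open>m - n\<close> positive and at least \<open>k\<close>.\<close>
  then obtain m where m: "m \<ge> n + k + 1" "(f ^^ m) x > q"
    unfolding frequently_sequentially by auto
  have "(f ^^ (m - n)) ((f ^^ n) x) = (f ^^ m) x"
    using m(1) by (simp flip: funpow_add[THEN fun_cong, unfolded o_apply])
  moreover have "k \<le> m - n" "0 < m - n" using m(1) by auto
  ultimately show False
    using homoclinic_right[of z "(f ^^ n) x" q k "m - n"] n m(2) assms by auto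
qed

lemma omega_limit_homoclinic:
  assumes "f z = z" "v \<in> omega_limit f x" "w \<in> omega_limit f x" "v < q" "q < w"
    and "z < v \<or> w < z" "(f ^^ k) q = z"
  shows False
  using assms(6)
proof
  assume "z < v" then show False using omega_limit_homoclinic_right assms by blast
next
  assume "w < z" then show False
    using no_horseshoe.omega_limit_homoclinic_right[OF no_horseshoe_reflect, of "-z" "-w" "-x" "-v" "-q" k]
      assms omega_limit_reflect by (auto simp: funpow_reflect reflect_def)
qed

text \<open>Let \<open>z\<close> be the least fixed point in \<open>[d, u]\<close>. Points of
  \<open>[d, z)\<close> move down, so each has a preimage between itself and \<open>z\<close>, and
  \<open>d\<close> can be pulled back arbitrarily often. On its way to \<open>u\<close> the orbit of
  \<open>d\<close> jumps over \<open>z\<close>, which yields a point \<open>q\<close> that later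
  hits \<open>z\<close>; a deep preimage of \<open>d\<close> lies between \<open>q\<close> and
  \<open>z\<close> and returns to \<open>d \<le> q\<close>.\<close>

lemma no_down_before_up_forward:
  assumes "f d < d" "d < u" "u < f u" "(f ^^ n) d = u"
  shows False
proof -
  define S where "S = {t \<in> {d..u}. f t = t}"
  have ivt: "\<exists>t\<in>{d..s}. f t = t" if "d \<le> s" "s \<le> f s" for s
  proof -
    have "\<exists>t\<ge>d. t \<le> s \<and> f t - t = 0"
      using that assms by (intro IVT') (auto intro!: continuous_intros continuous_on_subset[OF cont])
    then show ?thesis by auto
  qed
  have "S = {d..u} \<inter> {t. f t = t}" by (auto simp: S_def)
  moreover have "closed {t. f t = t}" using cont by (intro closed_Collect_eq continuous_intros)
  ultimately have "compact S" by (simp add: compact_Int_closed)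
  moreover have "S \<noteq> {}" using ivt[of u] assms by (auto simp: S_def)
  ultimately obtain z where z: "z \<in> S" "\<And>t. t \<in> S \<Longrightarrow> z \<le> t"
    using compact_attains_inf by metis
  have fz: "f z = z" "d < z" "z < u" using z(1) assms by (auto simp: S_def less_le)
  have down: "f t < t" if t: "d \<le> t" "t < z" for t
  proof (rule ccontr)
    assume "\<not> f t < t"
    then obtain s where "s \<in> {d..t}" "f s = s" using ivt[of t] t by auto
    then have "s \<in> S" using t fz by (auto simp: S_def)
    then show False using z(2)[of s] \<open>s \<in> {d..t}\<close> t by auto
  qed
  have pre: "\<exists>w. v < w \<and> w < z \<and> f w = v" if v: "d \<le> v" "v < z" for v
  proof -
    obtain w where "v \<le> w" "w \<le> z" "f w = v"
      using IVT'[of f v v z] down[OF v] v fz continuous_on_subset[OF cont] by auto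
    then show ?thesis using down[OF v] fz v by (metis less_le)
  qed
  obtain d1 where d1: "d < d1" "d1 < z" "f d1 = d" using pre[of d] fz by auto
  \<comment> \<open>Preimages of \<open>d\<close> of every depth inside \<open>[d1, z)\<close>,
    hence to the right of the point \<open>q\<close> found below.\<close>
  have chain: "\<exists>v. d1 \<le> v \<and> v < z \<and> (f ^^ Suc j) v = d" for j
  proof (induction j)
    case 0
    show ?case using d1 by auto
  next
    case (Suc j)
    then obtain v where v: "d1 \<le> v" "v < z" "(f ^^ Suc j) v = d" by blast
    obtain w where w: "v < w" "w < z" "f w = v" using pre[of v] v d1 by auto
    have "(f ^^ Suc (Suc j)) w = (f ^^ Suc j) (f w)" by (simp only: funpow_Suc_right o_apply)
    then have "(f ^^ Suc (Suc j)) w = d" using v w by simp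
    then show ?case using v(1) w(1,2) by (intro exI[of _ w]) auto
  qed
  define m where "m = (LEAST m. (f ^^ m) d > z)"
  have m: "(f ^^ m) d > z" unfolding m_def by (rule LeastI[of "\<lambda>m. (f ^^ m) d > z" n]) (use assms(4) fz in simp)
  then obtain m' where m': "m = Suc m'" using fz by (cases m) auto
  have "\<not> (f ^^ m') d > z" using not_less_Least[of m' "\<lambda>m. (f ^^ m) d > z"] m' by (auto simp: m_def)
  moreover have "(f ^^ m') d \<noteq> z" using m m' fz by auto
  ultimately have lt: "(f ^^ m') d < z" by simp
  \<comment> \<open>As \<open>d1\<close> is one step behind \<open>d\<close>, it is still left of
    \<open>z\<close> at the time \<open>m\<close> when \<open>d\<close> first passes
    \<open>z\<close>; so the iterate takes the value \<open>z\<close> between \<open>d\<close> and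
    \<open>d1\<close>.\<close>
  have "(f ^^ m) d1 = (f ^^ m') d" using d1 m' by (simp add: funpow_swap1)
  then obtain q where q: "d \<le> q" "q \<le> d1" "(f ^^ m) q = z"
    using IVT2'[of "f ^^ m" d1 z d] lt m d1 continuous_on_funpow by auto
  obtain v where v: "d1 \<le> v" "v < z" "(f ^^ Suc m) v = d" using chain by blast
  have "q \<noteq> d1" using q lt \<open>(f ^^ m) d1 = (f ^^ m') d\<close> by auto
  show False
    by (rule homoclinic_left[of z v q m "Suc m"]) (use fz v q \<open>q \<noteq> d1\<close> in auto)
qed

text \<open>Of two points on one orbit, one leads to the other. Reflection exchanges moving down
  with moving up, which settles the case where \<open>u\<close> comes first.\<close>

lemma no_down_left_of_up:
  assumes "f d < d" "d < u" "u < f u" "d = (f ^^ i) x" "u = (f ^^ j) x"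
  shows False
proof (cases "i \<le> j")
  case True
  then have "(f ^^ (j - i)) d = u"
    using assms by (simp flip: funpow_add[THEN fun_cong, unfolded o_apply])
  then show False using no_down_before_up_forward assms by blast
next
  case False
  then have "(f ^^ (i - j)) u = d"
    using assms by (simp flip: funpow_add[THEN fun_cong, unfolded o_apply])
  then show False
    using no_horseshoe.no_down_before_up_forward[OF no_horseshoe_reflect, of "-u" "-d" "i - j"] assms
    by (auto simp: reflect_def funpow_reflect)
qed

text \<open>A backward orbit of \<open>u\<close> inside the limit set consists of infinitely many preimages of \<open>z\<close>.\<close>

lemma omega_limit_preimage_fixed:
  assumes u: "u \<in> omega_limit f x" and z: "f z = z" and j: "(f ^^ j) u = z"
  shows "u = z"
proof (rule ccontr)
  assume "u \<noteq> z"
  have "\<exists>U. U 0 = u \<and> (\<forall>n. U n \<in> omega_limit f x \<and> f (U (Suc n)) = U n)"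
  proof -
    have "\<exists>U. \<forall>n. (U n \<in> omega_limit f x \<and> (n = 0 \<longrightarrow> U n = u)) \<and> f (U (Suc n)) = U n"
    proof (rule dependent_nat_choice[where P = "\<lambda>n v. v \<in> omega_limit f x \<and> (n = 0 \<longrightarrow> v = u)"
        and Q = "\<lambda>n v w. f w = v"])
      show "\<exists>v. v \<in> omega_limit f x \<and> ((0::nat) = 0 \<longrightarrow> v = u)" using u by blast
      show "\<exists>w. (w \<in> omega_limit f x \<and> (Suc n = 0 \<longrightarrow> w = u)) \<and> f w = v"
        if v: "v \<in> omega_limit f x \<and> (n = 0 \<longrightarrow> v = u)" for v n
      proof -
        obtain w where "w \<in> omega_limit f x" "f w = v" using omega_limit_preimage v by blast
        then show ?thesis by auto
      qed
    qed
    then show ?thesis by auto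
  qed
  then obtain U where U: "U 0 = u" "\<And>n. U n \<in> omega_limit f x" "\<And>n. f (U (Suc n)) = U n" by blast
  have it: "(f ^^ k) (U (n + k)) = U n" for n k
    by (induction k) (auto simp: funpow_swap1 U)
  have hits: "(f ^^ (j + n)) (U n) = z" for n
    using it[of n 0] j U(1) by (simp add: funpow_add)
  have ne: "U n \<noteq> z" for n
    using it[of n 0] funpow_fixed[of f z n, OF z] U(1) \<open>u \<noteq> z\<close> by auto
  \<comment> \<open>A repetition would make \<open>u\<close> periodic; since the orbit of
    \<open>u\<close> ends at the fixed point \<open>z\<close>, this forces
    \<open>u = z\<close>.\<close>
  have inj: "U m \<noteq> U (m + Suc p)" for m p
  proof
    assume eq: "U m = U (m + Suc p)"
    have "(f ^^ Suc p) u = (f ^^ Suc p) ((f ^^ m) (U m))" using it[of m 0] U by simp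
    also have "\<dots> = (f ^^ (m + Suc p)) (U (m + Suc p))"
      unfolding eq by (metis add.commute funpow_add o_apply)
    also have "\<dots> = u" using it[of "m + Suc p" 0] U by simp
    finally have "((f ^^ Suc p) ^^ j) u = u" by (rule funpow_fixed)
    moreover have "((f ^^ Suc p) ^^ j) u = (f ^^ (p * j)) ((f ^^ j) u)"
      unfolding funpow_mult by (metis add.commute funpow_add mult_Suc o_apply)
    ultimately show False using j \<open>u \<noteq> z\<close> funpow_fixed[of f z, OF z] by simp
  qed
  have "inj U"
  proof (rule linorder_injI)
    fix m n :: nat assume "m < n"
    then obtain p where "n = m + Suc p" using less_iff_Suc_add by auto
    then show "U m \<noteq> U n" using inj by simp
  qed
  then have "infinite (range U)" by (rule range_inj_infinite)
  moreover have "range U = (range U \<inter> {z<..}) \<union> (range U \<inter> {..<z})" using ne linorder_neqE by auto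
  ultimately have "infinite (range U \<inter> {z<..}) \<or> infinite (range U \<inter> {..<z})" by (metis finite_Un)
  \<comment> \<open>Of three preimages on one side of \<open>z\<close>, the outer two are limit
    points and the middle one eventually hits \<open>z\<close>: a forbidden configuration.\<close>
  then obtain a b c where abc: "a \<in> range U" "b \<in> range U" "c \<in> range U" "a < b" "b < c" "z < a \<or> c < z"
    by (elim disjE infinite_three_points) auto
  obtain n where "b = U n" using abc by blast
  then show False using omega_limit_homoclinic[of z a x c b "j + n"] abc hits z U(2) by blast
qed

section \<open>Limit sets containing a fixed point\<close>

text \<open>Otherwise there are limit points at distance at least \<open>e\<close> from
  \<open>z\<close> with images arbitrarily close to \<open>z\<close>, and compactness gives one
  mapped to \<open>z\<close>, against \<open>omega_limit_preimage_fixed\<close>. Continuity controls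
  closeness to \<open>z\<close> forward in time; this controls it backward.\<close>

lemma backward_near_fixed:
  assumes z: "f z = z" and e: "e > 0"
  shows "\<exists>d>0. \<forall>\<^sub>F n in sequentially. \<bar>(f ^^ Suc n) x - z\<bar> < d \<longrightarrow> \<bar>(f ^^ n) x - z\<bar> < e"
proof (rule ccontr)
  assume *: "\<not> ?thesis"
  have freq: "\<exists>\<^sub>F n in sequentially. \<bar>f ((f ^^ n) x) - z\<bar> < d \<and> \<bar>(f ^^ n) x - z\<bar> \<ge> e" if "d > 0" for d
  proof -
    have "\<not> (\<forall>\<^sub>F n in sequentially. \<bar>(f ^^ Suc n) x - z\<bar> < d \<longrightarrow> \<bar>(f ^^ n) x - z\<bar> < e)"
      using * that by blast
    then show ?thesis by (simp add: not_eventually not_less)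
  qed
  define L where "L = omega_limit f x \<inter> {t. e \<le> \<bar>t - z\<bar>}"
  have C: "closed {t. e \<le> \<bar>t - z\<bar>}" by (intro closed_Collect_le continuous_intros)
  have "\<exists>v\<in>omega_limit f x. v \<in> {t. \<bar>f t - z\<bar> \<le> d \<and> e \<le> \<bar>t - z\<bar>}" if "d > 0" for d
  proof (rule frequently_omega_limit)
    show "\<exists>\<^sub>F n in sequentially. (f ^^ n) x \<in> {t. \<bar>f t - z\<bar> \<le> d \<and> e \<le> \<bar>t - z\<bar>}"
      using freq[OF that] by (rule frequently_elim1) auto
    show "closed {t. \<bar>f t - z\<bar> \<le> d \<and> e \<le> \<bar>t - z\<bar>}"
      using cont by (intro closed_Collect_conj closed_Collect_le continuous_intros)
  qed
  then have small: "\<exists>v\<in>L. \<bar>f v - z\<bar> \<le> d" if "d > 0" for d using that by (force simp: L_def)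
  have "closed L" unfolding L_def omega_limit_def using C by (intro closed_Int closed_cluster)
  moreover have "L \<subseteq> {-M..M}" using omega_limit_subset by (auto simp: L_def)
  ultimately have "compact L" by (meson bounded_closed_interval bounded_subset compact_eq_bounded_closed)
  moreover have "L \<noteq> {}" using small[of 1] by auto
  moreover have "continuous_on L (\<lambda>v. \<bar>f v - z\<bar>)"
    by (intro continuous_intros continuous_on_subset[OF cont]) auto
  ultimately obtain v where v: "v \<in> L" "\<And>w. w \<in> L \<Longrightarrow> \<bar>f v - z\<bar> \<le> \<bar>f w - z\<bar>"
    using continuous_attains_inf[of L "\<lambda>v. \<bar>f v - z\<bar>"] by blast
  have "\<bar>f v - z\<bar> \<le> 0"
  proof (rule field_le_epsilon)
    fix d :: real assume "d > 0"
    then obtain w where "w \<in> L" "\<bar>f w - z\<bar> \<le> d" using small by blast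
    then show "\<bar>f v - z\<bar> \<le> 0 + d" using v(2)[of w] by simp
  qed
  then have "v = z" using omega_limit_preimage_fixed[of v x z 1] v(1) z by (auto simp: L_def)
  then show False using v(1) e by (simp add: L_def)
qed

section \<open>Orbits converging to a fixed point\<close>

lemma hits_fixed_tendsto:
  assumes "f z = z" "(f ^^ k) x = z"
  shows "(\<lambda>n. (f ^^ n) x) \<longlonglongrightarrow> z"
proof -
  have "(f ^^ n) x = z" if "n \<ge> k" for n
    using that assms by (metis funpow_add funpow_fixed le_add_diff_inverse2 o_apply)
  then have "\<forall>\<^sub>F n in sequentially. (f ^^ n) x = z" by (rule eventually_sequentiallyI)
  then show ?thesis by (rule tendsto_eventually)
qed

lemma monotone_orbit_tendsto:
  assumes "monoseq (\<lambda>n. (f ^^ (n + k)) x)" "v \<in> omega_limit f x"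
  shows "(\<lambda>n. (f ^^ n) x) \<longlonglongrightarrow> v" "f v = v"
proof -
  have "Bseq (\<lambda>n. (f ^^ (Suc n + k)) x)"
    by (rule BseqI'[of _ M]) (simp add: range_bounded)
  then have "Bseq (\<lambda>n. (f ^^ (n + k)) x)" using Bseq_Suc_iff[of "\<lambda>n. (f ^^ (n + k)) x"] by simp
  then have "convergent (\<lambda>n. (f ^^ (n + k)) x)" using assms(1) by (rule Bseq_monoseq_convergent)
  then obtain l where "(\<lambda>n. (f ^^ (n + k)) x) \<longlonglongrightarrow> l" by (auto simp: convergent_def)
  then have l: "(\<lambda>n. (f ^^ n) x) \<longlonglongrightarrow> l" by (rule LIMSEQ_offset)
  then have "v = l" using assms(2) tendsto_cluster_unique unfolding omega_limit_def by blast
  with l show 1: "(\<lambda>n. (f ^^ n) x) \<longlonglongrightarrow> v" by simp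
  then have "(\<lambda>n. f ((f ^^ n) x)) \<longlonglongrightarrow> f v" by (rule isCont_tendsto_compose[OF isCont_f])
  moreover have "(\<lambda>n. f ((f ^^ n) x)) \<longlonglongrightarrow> v" using LIMSEQ_Suc[OF 1] by simp
  ultimately show "f v = v" by (rule LIMSEQ_unique)
qed

text \<open>Suppose convergence fails. Orbit points left of the rising point \<open>u\<close> all
  move up. Backward control near \<open>z\<close> then forces infinitely many jumps from just left
  of \<open>z\<close> to its right, and infinitely many visits far to the left. A point
  \<open>q\<close> mapped to \<open>z\<close> just before a jump makes this homoclinic.\<close>

lemma up_right_of_fixed_tendsto:
  assumes z: "f z = z" "z \<in> omega_limit f x"
    and m: "z < (f ^^ m) x" "(f ^^ m) x < (f ^^ Suc m) x"
  shows "(\<lambda>n. (f ^^ n) x) \<longlonglongrightarrow> z"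
proof (rule ccontr)
  assume nlim: "\<not> ?thesis"
  define X where "X n = (f ^^ n) x" for n
  define u where "u = X m"
  have XS: "X (Suc n) = f (X n)" for n by (simp add: X_def)
  have zu: "z < u" using m by (simp add: u_def X_def)
  have ne: "X n \<noteq> z" for n using hits_fixed_tendsto[OF z(1)] nlim by (auto simp: X_def)
  \<comment> \<open>A point left of \<open>u\<close> that moves down is excluded by
    \<open>no_down_left_of_up\<close>; a fixed one would be the limit of the orbit, hence
    \<open>z\<close>.\<close>
  have up: "X n < X (Suc n)" if "X n < u" for n
  proof (rule ccontr)
    assume "\<not> X n < X (Suc n)"
    then consider "f (X n) < X n" | "f (X n) = X n" using XS by force
    then show False
    proof cases
      case 1
      then show False
        using no_down_left_of_up[of "X n" u n x m] that m by (auto simp: u_def X_def)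
    next
      case 2
      then have "X \<longlonglongrightarrow> X n" using hits_fixed_tendsto[of "X n" n x] unfolding X_def by blast
      then have "z = X n"
        using z(2) tendsto_cluster_unique[of X "X n" z] by (simp add: omega_limit_def X_def[abs_def])
      then show False using ne by metis
    qed
  qed
  have leave: "\<exists>n\<ge>k. u \<le> X n" for k
  proof (rule ccontr)
    assume "\<not> ?thesis"
    then have "X n < u" if "n \<ge> k" for n using that by force
    then have "X (n + k) \<le> X (Suc n + k)" for n using up[of "n + k"] by (simp add: less_imp_le)
    then have "monoseq (\<lambda>n. (f ^^ (n + k)) x)" unfolding monoseq_Suc X_def by blast
    then show False using monotone_orbit_tendsto(1) z(2) nlim by blast
  qed
  have near: "\<exists>n\<ge>k. \<bar>X n - z\<bar> < e" if "e > 0" for k e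
    using omega_limit_frequently[OF z(2), of "ball z e"] that
    unfolding frequently_sequentially by (auto simp: X_def dist_real_def abs_minus_commute)
  have NP: "\<exists>d>0. d \<le> e \<and> (\<exists>N. \<forall>n\<ge>N. \<bar>X (Suc n) - z\<bar> < d \<longrightarrow> \<bar>X n - z\<bar> < e)" if pos: "e > 0" for e
  proof -
    obtain d N where "d > 0" "\<forall>n\<ge>N. \<bar>X (Suc n) - z\<bar> < d \<longrightarrow> \<bar>X n - z\<bar> < e"
      using backward_near_fixed[OF z(1) pos, of x] unfolding eventually_sequentially X_def by blast
    then have "min d e > 0 \<and> min d e \<le> e \<and> (\<forall>n\<ge>N. \<bar>X (Suc n) - z\<bar> < min d e \<longrightarrow> \<bar>X n - z\<bar> < e)"
      using pos by auto
    then show ?thesis by blast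
  qed
  \<comment> \<open>Nested radii: at late times a point within \<open>e3\<close>, \<open>e2\<close>
    or \<open>e1\<close> of \<open>z\<close> has its predecessor within \<open>e2\<close>,
    \<open>e1\<close> or \<open>u - z\<close>. The last radius keeps the predecessor below
    \<open>u\<close>, where points move up.\<close>
  obtain e1 N1 where e1: "e1 > 0" "e1 \<le> u - z" "\<And>n. n \<ge> N1 \<Longrightarrow> \<bar>X (Suc n) - z\<bar> < e1 \<Longrightarrow> \<bar>X n - z\<bar> < u - z"
    using NP[of "u - z"] zu by auto
  obtain e2 N2 where e2: "e2 > 0" "e2 \<le> e1" "\<And>n. n \<ge> N2 \<Longrightarrow> \<bar>X (Suc n) - z\<bar> < e2 \<Longrightarrow> \<bar>X n - z\<bar> < e1"
    using NP[OF e1(1)] by auto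
  obtain e3 N3 where e3: "e3 > 0" "e3 \<le> e2" "\<And>n. n \<ge> N3 \<Longrightarrow> \<bar>X (Suc n) - z\<bar> < e3 \<Longrightarrow> \<bar>X n - z\<bar> < e2"
    using NP[OF e2(1)] by auto
  have crossing: "\<exists>i\<ge>K. z - e2 < X i \<and> X i < z \<and> z < X (Suc i)" for K
  proof (rule ccontr)
    assume "\<not> ?thesis"
    then have no: "\<not> (z - e2 < X i \<and> X i < z \<and> z < X (Suc i))" if "i \<ge> K" for i using that by blast
    define K' where "K' = K + N3"
    \<comment> \<open>After a close visit left of \<open>z\<close>, an orbit that no longer crosses
      would increase below \<open>z\<close> forever, against \<open>leave\<close>.\<close>
    have right: "z < X n" if n: "n \<ge> K'" "\<bar>X n - z\<bar> < e3" for n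
    proof (rule ccontr)
      assume "\<not> z < X n"
      have "z - e2 < X l \<and> X l < z" if "l \<ge> n" for l
        using that
      proof (induction l rule: dec_induct)
        case base
        show ?case using \<open>\<not> z < X n\<close> ne[of n] n e3 by auto
      next
        case (step l)
        have "X l < X (Suc l)" using up[of l] step zu by auto
        moreover have "\<not> z < X (Suc l)" using no[of l] step n by (auto simp: K'_def)
        ultimately show ?case using ne[of "Suc l"] step by auto
      qed
      then show False using leave[of n] zu by fastforce
    qed
    \<comment> \<open>Backward from a close visit on the right: the predecessor is within
      \<open>e2\<close>, moves up and is not left of \<open>z\<close>, so it lies between
      \<open>z\<close> and its successor. The late orbit would never reach \<open>u\<close>.\<close>
    have stay: "z < X l \<and> X l < z + e3" if l: "l \<ge> K'" for l
    proof -
      obtain n where n: "n \<ge> l" "\<bar>X n - z\<bar> < e3" using near[OF e3(1)] by blast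
      show ?thesis using n(1)
      proof (induction rule: inc_induct)
        case base
        show ?case using right[of n] n l by auto
      next
        case (step k)
        have k: "k \<ge> K'" using step l by auto
        have "\<bar>X k - z\<bar> < e2" using e3(3)[of k] step k by (auto simp: K'_def)
        moreover from this have "X k < X (Suc k)" using e1 e2 by (intro up) auto
        moreover have "\<not> X k < z" using no[of k] step k \<open>\<bar>X k - z\<bar> < e2\<close> by (auto simp: K'_def)
        ultimately show ?case using ne[of k] step by auto
      qed
    qed
    then show False using leave[of K'] e1 e2 e3 by force
  qed
  have far: "\<exists>n\<ge>K. X n \<le> z - e1" for K
  proof (rule ccontr)
    assume "\<not> ?thesis"
    then have no: "z - e1 < X n" if "n \<ge> K" for n using that by force
    \<comment> \<open>Backward from the left end of a crossing: above \<open>z - e1\<close> the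
      predecessor of a point left of \<open>z\<close> moves up, so it is left of \<open>z\<close>
      too. As crossings recur, the late orbit would stay left of \<open>z\<close>.\<close>
    have "X l < z" if l: "l \<ge> K + N1" for l
    proof -
      obtain n where n: "n \<ge> l" "X n < z" using crossing[of l] by blast
      show ?thesis using n
      proof (induction rule: inc_induct)
        case (step k)
        have "\<bar>X (Suc k) - z\<bar> < e1" using no[of "Suc k"] step l e1 by auto
        then have "\<bar>X k - z\<bar> < u - z" using e1(3)[of k] step l by auto
        then have "X k < X (Suc k)" by (intro up) auto
        then show ?case using step by auto
      qed simp
    qed
    then show False using leave[of "K + N1"] zu by fastforce
  qed
  \<comment> \<open>For the consecutive points \<open>X i < X j < z < X (Suc j)\<close>, the values
    of \<open>f\<close> at \<open>X i\<close> and \<open>X j\<close> enclose \<open>z\<close>, which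
    gives \<open>q\<close> between these two. A later visit below \<open>z - e1\<close> is left of
    \<open>X i\<close>, hence of \<open>q\<close>.\<close>
  obtain j where j: "j \<ge> Suc (N1 + N2)" "z - e2 < X j" "X j < z" "z < X (Suc j)" using crossing by blast
  then obtain i where i: "j = Suc i" "i \<ge> N1 + N2" by (cases j) auto
  have near_i: "\<bar>X i - z\<bar> < e1" using e2(3)[of i] i j by auto
  then have up_i: "X i < X j" unfolding i(1) using e1 by (intro up) auto
  obtain q where q: "X i \<le> q" "q \<le> X j" "f q = z"
    using IVT'[of f "X i" z "X j"] up_i i j XS continuous_on_subset[OF cont] by force
  have "q \<noteq> X i" "q \<noteq> X j" using q i j XS by force+
  obtain n where n: "n \<ge> Suc j" "X n \<le> z - e1" using far by blast
  have "(f ^^ (n - j)) (X j) = X n"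
    using n(1) by (simp add: X_def flip: funpow_add[THEN fun_cong, unfolded o_apply])
  moreover have "1 \<le> n - j" "0 < n - j" using n(1) by auto
  ultimately show False
    using homoclinic_left[of z "X j" q 1 "n - j"] z(1) j q n near_i \<open>q \<noteq> X j\<close> \<open>q \<noteq> X i\<close> by auto
qed

lemma down_left_of_fixed_tendsto:
  assumes z: "f z = z" "z \<in> omega_limit f x"
    and m: "(f ^^ m) x < z" "(f ^^ Suc m) x < (f ^^ m) x"
  shows "(\<lambda>n. (f ^^ n) x) \<longlonglongrightarrow> z"
proof -
  have "(\<lambda>n. (reflect f ^^ n) (-x)) \<longlonglongrightarrow> -z"
    by (rule no_horseshoe.up_right_of_fixed_tendsto[OF no_horseshoe_reflect, of _ _ m])
      (use assms omega_limit_reflect in \<open>auto simp: funpow_reflect reflect_def\<close>)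
  then show ?thesis by (simp add: funpow_reflect tendsto_minus_cancel_left)
qed

text \<open>Some residue class \<open>s\<close> of times clusters at \<open>z\<close>; a further
  \<open>r - s\<close> steps fix \<open>z\<close> and bring these times to multiples of
  \<open>r\<close>.\<close>

lemma omega_limit_funpow_fixed:
  assumes "f z = z" "z \<in> omega_limit f x" "r > 0"
  shows "z \<in> omega_limit (f ^^ r) x"
proof -
  obtain s where s: "s < r" "cluster (\<lambda>n. (f ^^ (s + r * n)) x) z"
    using cluster_residue[of "\<lambda>n. (f ^^ n) x" z r] assms by (auto simp: omega_limit_def)
  have "cluster (\<lambda>n. (f ^^ (r - s)) ((f ^^ (s + r * n)) x)) ((f ^^ (r - s)) z)"
    using s(2) isCont_funpow by (rule cluster_map)
  moreover have "(f ^^ (r - s)) ((f ^^ (s + r * n)) x) = ((f ^^ r) ^^ (n + 1)) x" for n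
  proof -
    have "(f ^^ (r - s)) ((f ^^ (s + r * n)) x) = (f ^^ ((r - s) + (s + r * n))) x"
      by (simp only: funpow_add o_apply)
    also have "(r - s) + (s + r * n) = r * (n + 1)" using s(1) by simp
    finally show ?thesis by (simp only: funpow_mult)
  qed
  ultimately have "cluster (\<lambda>n. ((f ^^ r) ^^ (n + 1)) x) z" using assms(1) by (simp add: funpow_fixed)
  then show ?thesis unfolding omega_limit_def mem_Collect_eq
    using cluster_shift[of "\<lambda>n. ((f ^^ r) ^^ n) x" 1 z] by blast
qed

text \<open>The odd terms are the images of the even ones, so continuity at the fixed point gives
  them the same limit.\<close>

lemma tendsto_square_iterate:
  assumes z: "f z = z" and lim: "(\<lambda>n. ((f ^^ 2) ^^ n) ((f ^^ m) x)) \<longlonglongrightarrow> z"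
  shows "(\<lambda>n. (f ^^ n) x) \<longlonglongrightarrow> z"
proof -
  define Y where "Y n = (f ^^ (n + m)) x" for n
  have even: "(\<lambda>n. Y (2 * n)) \<longlonglongrightarrow> z"
    using lim by (simp add: Y_def funpow_mult funpow_add)
  then have odd: "(\<lambda>n. Y (2 * n + 1)) \<longlonglongrightarrow> z"
    using isCont_tendsto_compose[OF isCont_f, of _ z] z by (fastforce simp: Y_def)
  have "Y \<longlonglongrightarrow> z"
  proof (rule tendstoI)
    fix e :: real assume e: "e > 0"
    obtain N where N: "\<And>n. n \<ge> N \<Longrightarrow> dist (Y (2 * n)) z < e" "\<And>n. n \<ge> N \<Longrightarrow> dist (Y (2 * n + 1)) z < e"
      using eventually_conj[OF tendstoD[OF even e] tendstoD[OF odd e]] unfolding eventually_sequentially by blast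
    have "dist (Y n) z < e" if "n \<ge> 2 * N" for n
    proof -
      have "n div 2 \<ge> N" using that by simp
      then show ?thesis using N[of "n div 2"] by (cases "even n") (auto elim!: evenE oddE)
    qed
    then show "\<forall>\<^sub>F n in sequentially. dist (Y n) z < e" by (rule eventually_sequentiallyI)
  qed
  then show ?thesis unfolding Y_def by (rule LIMSEQ_offset)
qed

text \<open>Right of \<open>z\<close> neither \<open>f\<close> nor \<open>f \<circ> f\<close> moves
  orbit points up, and left of \<open>z\<close> the map \<open>f\<close> does not move them down. So
  the orbit reaches \<open>z + d\<close> after a close visit only by way of two consecutive points
  left of \<open>z\<close>. A limit point \<open>v\<close> of such times has, between
  \<open>v\<close> and \<open>f v\<close>, a point mapped to \<open>z\<close>.\<close>

lemma fixed_omega_limit_not_far_right: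
  assumes z: "f z = z" "z \<in> omega_limit f x" and nlim: "\<not> (\<lambda>n. (f ^^ n) x) \<longlonglongrightarrow> z"
    and d: "d > 0" "\<exists>\<^sub>F n in sequentially. z + d \<le> (f ^^ n) x"
  shows False
proof -
  define X where "X n = (f ^^ n) x" for n
  have XS: "X (Suc n) = f (X n)" for n by (simp add: X_def)
  have ne: "X n \<noteq> z" for n using hits_fixed_tendsto[OF z(1)] nlim by (auto simp: X_def)
  have r1: "X (Suc n) \<le> X n" if "z < X n" for n
    using up_right_of_fixed_tendsto[OF z, of n] nlim that unfolding X_def by force
  have l1: "X n \<le> X (Suc n)" if "X n < z" for n
    using down_left_of_fixed_tendsto[OF z, of n] nlim that unfolding X_def by force
  \<comment> \<open>The square \<open>f ^^ 2\<close> has no horseshoe either and keeps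
    \<open>z\<close> in its limit set, so a rise over two steps would make the orbit converge to
    \<open>z\<close>.\<close>
  have r2: "X (Suc (Suc n)) \<le> X n" if "z < X n" for n
  proof (rule ccontr)
    assume "\<not> ?thesis"
    moreover have "(f ^^ 2) (X n) = X (Suc (Suc n))" by (simp add: X_def numeral_2_eq_2)
    ultimately have "(\<lambda>k. ((f ^^ 2) ^^ k) ((f ^^ n) x)) \<longlonglongrightarrow> z"
      using no_horseshoe.up_right_of_fixed_tendsto[OF no_horseshoe_funpow[of 2], of z "X n" 0]
        omega_limit_funpow_fixed[of z "X n" 2] z that
      by (auto simp: X_def omega_limit_shift funpow_fixed)
    then show False using tendsto_square_iterate z(1) nlim by blast
  qed
  \<comment> \<open>Weak inequalities keep \<open>C\<close> closed, so it passes to limit points;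
    strictness is recovered below from \<open>d > 0\<close>.\<close>
  define C where "C = {v. v \<le> f v \<and> f v \<le> z \<and> z + d \<le> f (f v)}"
  have "closed C" unfolding C_def
    by (intro closed_Collect_conj closed_Collect_le continuous_intros cont
        continuous_on_compose2[OF cont cont]) auto
  moreover have "\<exists>\<^sub>F n in sequentially. X n \<in> C"
    unfolding frequently_sequentially
  proof
    fix K
    obtain e where e: "e > 0" "\<And>t. dist t z < e \<Longrightarrow> dist (f t) (f z) < d"
      using isCont_f[of z] d(1) unfolding continuous_at_eps_delta by blast
    obtain s where s: "s \<ge> K" "dist (X s) z < min e d"
      using omega_limit_frequently[OF z(2), of "ball z (min e d)"] e(1) d(1)
      unfolding frequently_sequentially X_def by (auto simp: dist_commute)
    define P where "P j \<longleftrightarrow> j > s \<and> z + d \<le> X j" for j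
    have "\<exists>j. P j" using d(2) unfolding frequently_sequentially P_def X_def
      by (meson Suc_le_lessD)
    then have P: "P (Least P)" by (rule LeastI_ex)
    \<comment> \<open>By continuity at \<open>z\<close> one step from \<open>X s\<close> cannot
      reach \<open>z + d\<close>, so the first passage has two predecessors at times not before
      \<open>s\<close>.\<close>
    have "Least P \<noteq> Suc s"
    proof
      assume "Least P = Suc s"
      then have "z + d \<le> f (X s)" using P XS by (simp add: P_def)
      moreover have "dist (f (X s)) z < d" using e(2)[of "X s"] s(2) z(1) by simp
      ultimately show False by (simp add: dist_real_def)
    qed
    then have "Suc s < Least P" using P by (simp add: P_def)
    moreover define p where "p = Least P - 2"
    ultimately have p: "Least P = Suc (Suc p)" "p \<ge> s" by auto
    have far: "z + d \<le> X (Suc (Suc p))" using P p by (simp add: P_def)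
    have "\<not> P p" "\<not> P (Suc p)" by (rule not_less_Least, simp add: p(1))+
    then have below: "X p < z + d" "X (Suc p) < z + d"
      using p s(2) by (auto simp: P_def dist_real_def not_le le_less)
    have "X (Suc p) \<le> z" using r1[of "Suc p"] far below by force
    moreover have "X p < z" using r2[of p] far below ne[of p] by force
    ultimately have "X p \<in> C" using l1[of p] far XS by (simp add: C_def)
    then show "\<exists>n\<ge>K. X n \<in> C" using p s by (meson order_trans)
  qed
  ultimately obtain v where v: "v \<in> omega_limit f x" "v \<in> C"
    using frequently_omega_limit[of x C] unfolding X_def by blast
  have "f v \<noteq> z" using v d z by (auto simp: C_def)
  then have fv: "f v < z" using v by (auto simp: C_def)
  have "v \<noteq> f v" using v fv d by (auto simp: C_def)
  then have "v < f v" using v by (auto simp: C_def)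
  obtain q where q: "v \<le> q" "q \<le> f v" "f q = z"
    using IVT'[of f v z "f v"] fv \<open>v < f v\<close> v d continuous_on_subset[OF cont] by (auto simp: C_def)
  have "q \<noteq> v" "q \<noteq> f v" using q fv v d by (auto simp: C_def)
  then show False
    using omega_limit_homoclinic[of z v x "f v" q 1] v omega_limit_image q fv z by auto
qed

text \<open>Without convergence the orbit is infinitely often at some distance \<open>d\<close> from
  \<open>z\<close> on one fixed side; the right side is already excluded, and reflection excludes
  the left.\<close>

theorem fixed_omega_limit_tendsto:
  assumes z: "f z = z" "z \<in> omega_limit f x"
  shows "(\<lambda>n. (f ^^ n) x) \<longlonglongrightarrow> z"
proof (rule ccontr)
  assume nlim: "\<not> ?thesis"
  then obtain d where d: "d > 0" "\<exists>\<^sub>F n in sequentially. \<not> dist ((f ^^ n) x) z < d"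
    unfolding tendsto_iff by (auto simp: not_eventually)
  have "\<exists>\<^sub>F n in sequentially. z + d \<le> (f ^^ n) x \<or> (f ^^ n) x \<le> z - d"
    using d(2) by (rule frequently_elim1) (auto simp: dist_real_def)
  then consider "\<exists>\<^sub>F n in sequentially. z + d \<le> (f ^^ n) x" | "\<exists>\<^sub>F n in sequentially. (f ^^ n) x \<le> z - d"
    by (auto simp: frequently_disj_iff)
  then show False
  proof cases
    case 1
    then show False using fixed_omega_limit_not_far_right[OF z nlim d(1)] by blast
  next
    case 2
    have "\<exists>\<^sub>F n in sequentially. - z + d \<le> (reflect f ^^ n) (-x)"
      using 2 by (rule frequently_elim1) (auto simp: funpow_reflect)
    moreover have "\<not> (\<lambda>n. (reflect f ^^ n) (-x)) \<longlonglongrightarrow> - z"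
      using nlim by (simp add: funpow_reflect tendsto_minus_cancel_left)
    moreover have "reflect f (-z) = -z" using z by (simp add: reflect_def)
    ultimately show False
      using no_horseshoe.fixed_omega_limit_not_far_right[OF no_horseshoe_reflect _ omega_limit_reflect[OF z(2)] _ d(1)]
      by blast
  qed
qed

section \<open>Sides of a fixed point\<close>

lemma eventually_avoids:
  assumes "z \<notin> omega_limit f x"
  shows "\<forall>\<^sub>F n in sequentially. (f ^^ n) x \<noteq> z"
  using eventually_omega_limit[of "- {z}" x] assms by auto

text \<open>Some \<open>q\<close> between \<open>v\<close> and \<open>w\<close> is mapped to
  \<open>z\<close>, while both limit points lie left of \<open>z\<close>: a homoclinic
  configuration.\<close>

lemma omega_limit_left_images:
  assumes "f z = z" "v \<in> omega_limit f x" "w \<in> omega_limit f x" "v < z" "w < z" "f v < z" "z < f w"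
  shows False
proof (cases "v < w")
  case True
  then obtain q where q: "v \<le> q" "q \<le> w" "f q = z"
    using IVT'[of f v z w] assms continuous_on_subset[OF cont] by auto
  then have "v < q" "q < w" using assms by (auto simp: less_le)
  then show False using omega_limit_homoclinic[of z v x w q 1] q assms by auto
next
  case False
  then obtain q where q: "w \<le> q" "q \<le> v" "f q = z"
    using IVT2'[of f v z w] assms continuous_on_subset[OF cont] by auto
  then have "w < q" "q < v" using assms by (auto simp: less_le)
  then show False using omega_limit_homoclinic[of z w x v q 1] q assms by auto
qed

text \<open>Limit points left of \<open>z\<close> all have their images on one side, by
  \<open>omega_limit_left_images\<close>. Exceptional late times would accumulate at a limit point
  violating this, with strict inequalities because \<open>z\<close> is not in the limit set.\<close>

lemma eventually_step_left:
  assumes z: "f z = z" "z \<notin> omega_limit f x" and v: "v \<in> omega_limit f x" "v < z"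
  shows "\<forall>\<^sub>F n in sequentially. (f ^^ n) x < z \<longrightarrow> ((f ^^ Suc n) x < z \<longleftrightarrow> f v < z)"
proof (rule ccontr)
  assume "\<not> ?thesis"
  then have freq: "\<exists>\<^sub>F n in sequentially. (f ^^ n) x < z \<and> (f ((f ^^ n) x) < z) \<noteq> (f v < z)"
    by (simp add: not_eventually)
  have ne: "w \<noteq> z" if "w \<in> omega_limit f x" for w using that z by auto
  show False
  proof (cases "f v < z")
    case True
    have "\<exists>\<^sub>F n in sequentially. (f ^^ n) x \<in> {t. t \<le> z \<and> z \<le> f t}"
      using freq by (rule frequently_elim1) (use True in auto)
    moreover have "closed {t. t \<le> z \<and> z \<le> f t}"
      using cont by (intro closed_Collect_conj closed_Collect_le continuous_intros)
    ultimately obtain w where w: "w \<in> omega_limit f x" "w \<le> z" "z \<le> f w"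
      using frequently_omega_limit by blast
    then have "w < z" "z < f w" using ne[of w] ne[OF omega_limit_image[of w]] by auto
    then show False using omega_limit_left_images[of z v x w] z v w True by blast
  next
    case False
    have "\<exists>\<^sub>F n in sequentially. (f ^^ n) x \<in> {t. t \<le> z \<and> f t \<le> z}"
      using freq by (rule frequently_elim1) (use False in auto)
    moreover have "closed {t. t \<le> z \<and> f t \<le> z}"
      using cont by (intro closed_Collect_conj closed_Collect_le continuous_intros)
    ultimately obtain w where w: "w \<in> omega_limit f x" "w \<le> z" "f w \<le> z"
      using frequently_omega_limit by blast
    then have "w < z" "f w < z" using ne[of w] ne[OF omega_limit_image[of w]] by auto
    moreover have "z < f v" using False ne[OF omega_limit_image[OF v(1)]] by auto
    ultimately show False using omega_limit_left_images[of z w x v] z v w by blast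
  qed
qed

text \<open>The one-step rule makes the left side absorbing at late times, and the orbit visits it
  near \<open>p\<close>.\<close>

lemma eventually_left:
  assumes z: "f z = z" "z \<notin> omega_limit f x" and p: "p \<in> omega_limit f x" "p < z" "f p < z"
  shows "\<forall>\<^sub>F n in sequentially. (f ^^ n) x < z"
proof -
  obtain N where N: "\<And>n. n \<ge> N \<Longrightarrow> (f ^^ n) x < z \<Longrightarrow> (f ^^ Suc n) x < z"
    using eventually_step_left[OF z p(1,2)] p(3) unfolding eventually_sequentially by blast
  obtain k where k: "k \<ge> N" "(f ^^ k) x < z"
    using omega_limit_frequently[OF p(1), of "{..<z}"] p(2) unfolding frequently_sequentially by auto
  have "(f ^^ n) x < z" if "n \<ge> k" for n
    using that
  proof (induction n rule: dec_induct)
    case (step n)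
    then show ?case using N[of n] k by simp
  qed (use k in simp)
  then show ?thesis by (rule eventually_sequentiallyI)
qed

lemma eventually_right:
  assumes z: "f z = z" "z \<notin> omega_limit f x" and p: "p \<in> omega_limit f x" "z < p" "z < f p"
  shows "\<forall>\<^sub>F n in sequentially. z < (f ^^ n) x"
  using no_horseshoe.eventually_left[OF no_horseshoe_reflect, of "-z" "-x" "-p"] assms
  by (simp add: omega_limit_reflect_iff funpow_reflect) (simp add: reflect_def)

lemma eventually_step_right:
  assumes z: "f z = z" "z \<notin> omega_limit f x" and v: "v \<in> omega_limit f x" "z < v"
  shows "\<forall>\<^sub>F n in sequentially. z < (f ^^ n) x \<longrightarrow> (z < (f ^^ Suc n) x \<longleftrightarrow> z < f v)"
  using no_horseshoe.eventually_step_left[OF no_horseshoe_reflect, of "-z" "-x" "-v"] assms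
  unfolding omega_limit_reflect_iff funpow_reflect by (simp add: reflect_def)

text \<open>The order of quantifiers matters: \<open>\<phi>\<close> is chosen before
  \<open>x\<close>, so all orbits sharing the limit point \<open>p\<close> obey one rule. The rule
  is to stay left if \<open>f p < z\<close> and to alternate otherwise.\<close>

lemma side_rule_left:
  assumes z: "f z = z" and "p < z"
  shows "\<exists>\<phi>. \<forall>x. p \<in> omega_limit f x \<longrightarrow> z \<notin> omega_limit f x \<longrightarrow>
    (\<forall>\<^sub>F n in sequentially. ((f ^^ Suc n) x < z) = \<phi> ((f ^^ n) x < z))"
proof (cases "f p < z")
  case True
  have "\<forall>\<^sub>F n in sequentially. ((f ^^ Suc n) x < z) = True"
    if "p \<in> omega_limit f x" "z \<notin> omega_limit f x" for x
    using eventually_left[OF z that(2,1) assms(2) True]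
      eventually_sequentially_Suc[of "\<lambda>n. (f ^^ n) x < z"] by simp
  then show ?thesis by (intro exI[of _ "\<lambda>_. True"]) blast
next
  case False
  have "\<forall>\<^sub>F n in sequentially. ((f ^^ Suc n) x < z) = (\<not> (f ^^ n) x < z)"
    if x: "p \<in> omega_limit f x" "z \<notin> omega_limit f x" for x
  proof -
    have fp: "f p \<in> omega_limit f x" using x omega_limit_image by blast
    then have "z < f p" using False x(2) by (metis linorder_neqE)
    \<comment> \<open>If \<open>f p\<close> and its image were both right of \<open>z\<close>, the
      orbit would eventually stay right, yet it returns near \<open>p\<close> on the left.\<close>
    have "\<not> z < f (f p)"
    proof
      assume "z < f (f p)"
      then have "\<forall>\<^sub>F n in sequentially. z < (f ^^ n) x"
        using eventually_right[OF z x(2) fp \<open>z < f p\<close>] by blast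
      moreover have "\<exists>\<^sub>F n in sequentially. (f ^^ n) x \<in> {..<z}"
        by (rule omega_limit_frequently[OF x(1)]) (use assms in auto)
      ultimately have "\<exists>\<^sub>F n in sequentially. (f ^^ n) x \<in> {..<z} \<and> z < (f ^^ n) x"
        by (rule frequently_eventually_frequently[rotated])
      then show False using frequently_ex by fastforce
    qed
    have "\<forall>\<^sub>F n in sequentially. (f ^^ Suc n) x \<noteq> z"
      using eventually_avoids[OF x(2)] eventually_sequentially_Suc[of "\<lambda>n. (f ^^ n) x \<noteq> z"] by blast
    with eventually_step_left[OF z x(2,1) assms(2)] eventually_step_right[OF z x(2) fp \<open>z < f p\<close>]
      eventually_avoids[OF x(2)]
    show ?thesis
      by eventually_elim (use False \<open>\<not> z < f (f p)\<close> in auto)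
  qed
  then show ?thesis by (intro exI[of _ Not]) blast
qed

lemma side_rule:
  assumes z: "f z = z" and "p \<noteq> z"
  obtains \<phi> where "\<And>x. p \<in> omega_limit f x \<Longrightarrow> z \<notin> omega_limit f x \<Longrightarrow>
    \<forall>\<^sub>F n in sequentially. ((f ^^ Suc n) x < z) = \<phi> ((f ^^ n) x < z)"
proof (cases "p < z")
  case True
  then show ?thesis using side_rule_left[OF z] that by blast
next
  case False
  have "reflect f (-z) = -z" "-p < -z" using z False assms(2) by (auto simp: reflect_def)
  from no_horseshoe.side_rule_left[OF no_horseshoe_reflect this]
  obtain \<psi> where \<psi>: "\<And>x. -p \<in> omega_limit (reflect f) x \<Longrightarrow> -z \<notin> omega_limit (reflect f) x \<Longrightarrow>
    \<forall>\<^sub>F n in sequentially. ((reflect f ^^ Suc n) x < -z) = \<psi> ((reflect f ^^ n) x < -z)" by blast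
  \<comment> \<open>Reflection swaps the sides, hence the negations around \<open>\<psi>\<close>;
    since the late orbit avoids \<open>z\<close>, not being left means being right.\<close>
  have "\<forall>\<^sub>F n in sequentially. ((f ^^ Suc n) x < z) = (\<not> \<psi> (\<not> (f ^^ n) x < z))"
    if x: "p \<in> omega_limit f x" "z \<notin> omega_limit f x" for x
  proof -
    have "\<forall>\<^sub>F n in sequentially. (z < (f ^^ Suc n) x) = \<psi> (z < (f ^^ n) x)"
      using \<psi>[of "-x"] x unfolding omega_limit_reflect_iff funpow_reflect by simp
    moreover have "\<forall>\<^sub>F n in sequentially. (f ^^ Suc n) x \<noteq> z"
      using eventually_avoids[OF x(2)] eventually_sequentially_Suc[of "\<lambda>n. (f ^^ n) x \<noteq> z"] by blast
    ultimately show ?thesis using eventually_avoids[OF x(2)]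
    proof eventually_elim
      case (elim n)
      have flip: "(\<not> (f ^^ n) x < z) = (z < (f ^^ n) x)" "(\<not> (f ^^ Suc n) x < z) = (z < (f ^^ Suc n) x)"
        using elim by auto
      have "\<psi> (\<not> (f ^^ n) x < z) = (\<not> (f ^^ Suc n) x < z)" unfolding flip using elim(1) by (rule sym)
      then show ?case by blast
    qed
  qed
  then show ?thesis by (rule that)
qed

section \<open>Triples\<close>

text \<open>Otherwise each \<open>h k\<close> is free of zeros on \<open>(a, c)\<close> and has
  constant sign there. Since \<open>t\<close> and \<open>f t\<close> both lie in the interval,
  \<open>h (Suc k) t = h k (f t)\<close> makes this sign the same for all \<open>k\<close>. The
  orbit of \<open>y\<close> is then monotone after a visit to \<open>(a, c)\<close>, so
  \<open>b\<close> is itself fixed.\<close>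

lemma interval_reaches_fixed:
  assumes b: "b \<in> omega_limit f y" "a < b" "b < c"
    and t: "t \<in> {a<..<c}" "f t \<in> {a<..<c}"
  shows "\<exists>q k z. a < q \<and> q < c \<and> f z = z \<and> (f ^^ k) q = z"
proof (rule ccontr)
  assume "\<not> ?thesis"
  then have no: "f ((f ^^ k) q) \<noteq> (f ^^ k) q" if "q \<in> {a<..<c}" for q k using that by auto
  define h where "h k s = (f ^^ Suc k) s - (f ^^ k) s" for k s
  have sign: "h k s > 0" if s: "s \<in> {a<..<c}" "s' \<in> {a<..<c}" "h k s' > 0" for k s s'
  proof (rule ccontr)
    assume "\<not> h k s > 0"
    have "continuous_on {a<..<c} (h k)"
      unfolding h_def by (intro continuous_intros continuous_on_funpow)
    then have "connected (h k ` {a<..<c})" by (intro connected_continuous_image) auto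
    then have "0 \<in> h k ` {a<..<c}"
      using connectedD_interval[of "h k ` {a<..<c}" "h k s" "h k s'" 0] s \<open>\<not> h k s > 0\<close> by auto
    then show False using no by (auto simp: h_def)
  qed
  have shift: "h (Suc k) t = h k (f t)" for k by (simp add: h_def funpow_swap1)
  obtain N where N: "(f ^^ N) y \<in> {a<..<c}"
    using frequently_ex[OF omega_limit_frequently[OF b(1), of "{a<..<c}"]] b by auto
  have orb: "h k ((f ^^ N) y) = (f ^^ (Suc k + N)) y - (f ^^ (k + N)) y" for k
    by (simp add: h_def funpow_add)
  have "monoseq (\<lambda>n. (f ^^ (n + N)) y)"
  proof (cases "h 0 t > 0")
    case True
    have "h k t > 0" for k
    proof (induction k)
      case (Suc k)
      then show ?case unfolding shift by (rule sign[OF t(2,1)])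
    qed (rule True)
    then have "h k ((f ^^ N) y) > 0" for k using sign[OF N t(1)] by blast
    then have "(f ^^ (k + N)) y \<le> (f ^^ (Suc k + N)) y" for k
      unfolding orb by (metis diff_gt_0_iff_gt less_imp_le)
    then show ?thesis unfolding monoseq_Suc by blast
  next
    case False
    have "\<not> h k t > 0" for k
    proof (induction k)
      case (Suc k)
      then show ?case unfolding shift using sign[OF t(1,2)] by blast
    qed (rule False)
    then have "\<not> h k ((f ^^ N) y) > 0" for k using sign[OF t(1) N] by blast
    then have "(f ^^ (Suc k + N)) y \<le> (f ^^ (k + N)) y" for k
      unfolding orb by (metis diff_gt_0_iff_gt not_less)
    then show ?thesis unfolding monoseq_Suc by blast
  qed
  then have "f b = b" using monotone_orbit_tendsto(2) b(1) by blast
  then show False using no[of b 0] b by simp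
qed

lemma joint_cluster_omega_limit:
  assumes "cluster (joint f x y w) (a, b, c)"
  shows "a \<in> omega_limit f x" "b \<in> omega_limit f y" "c \<in> omega_limit f w"
proof -
  show "a \<in> omega_limit f x"
    using cluster_map[OF assms, of fst] by (simp add: joint_def omega_limit_def)
  show "b \<in> omega_limit f y"
    using cluster_map[OF assms, of "\<lambda>t. fst (snd t)"] by (simp add: joint_def omega_limit_def)
  show "c \<in> omega_limit f w"
    using cluster_map[OF assms, of "\<lambda>t. snd (snd t)"] by (simp add: joint_def omega_limit_def)
qed

text \<open>The core case, where \<open>(a, c)\<close> meets its image under \<open>f\<close>
  itself; the general case reduces to it by passing to a power.\<close>

lemma no_ordered_triple_returning:
  assumes abc: "cluster (joint f x y w) (a, b, c)" "a < b" "b < c"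
    and p: "cluster (joint f x y w) (p, p, p)"
    and t: "t \<in> {a<..<c}" "f t \<in> {a<..<c}"
  shows False
proof -
  note om = joint_cluster_omega_limit[OF abc(1)] and omp = joint_cluster_omega_limit[OF p]
  have unique: "v = z" if "f z = z" "z \<in> omega_limit f u" "v \<in> omega_limit f u" for u v z
    using tendsto_cluster_unique[OF fixed_omega_limit_tendsto[OF that(1,2)]] that(3)
    by (simp add: omega_limit_def)
  \<comment> \<open>A fixed point in one of these limit sets equals \<open>p\<close> and thus lies
    in all of them; then \<open>a\<close> and \<open>b\<close> both equal it.\<close>
  have nofix: "z \<notin> omega_limit f u" if "f z = z" "u \<in> {x, y, w}" for z u
  proof
    assume "z \<in> omega_limit f u"
    then have "p = z" using unique[OF that(1)] that(2) omp by blast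
    then have "a = z" "b = z" using unique[OF that(1), of x a] unique[OF that(1), of y b] om omp by auto
    then show False using abc by simp
  qed
  obtain q k z where q: "a < q" "q < c" "f z = z" "(f ^^ k) q = z"
    using interval_reaches_fixed[OF om(2) abc(2,3) t] by blast
  have zx: "z \<notin> omega_limit f x" and zw: "z \<notin> omega_limit f w" using nofix q(3) by auto
  have "p \<noteq> z" using zx omp by blast
  obtain \<phi> where \<phi>: "\<And>x. p \<in> omega_limit f x \<Longrightarrow> z \<notin> omega_limit f x \<Longrightarrow>
    \<forall>\<^sub>F n in sequentially. ((f ^^ Suc n) x < z) = \<phi> ((f ^^ n) x < z)"
    using side_rule[OF q(3) \<open>p \<noteq> z\<close>] by blast
  obtain N where N: "\<And>n. n \<ge> N \<Longrightarrow> ((f ^^ Suc n) x < z) = \<phi> ((f ^^ n) x < z)"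
    "\<And>n. n \<ge> N \<Longrightarrow> ((f ^^ Suc n) w < z) = \<phi> ((f ^^ n) w < z)"
    using eventually_conj[OF \<phi>[OF omp(1) zx] \<phi>[OF omp(3) zw]] unfolding eventually_sequentially by blast
  \<comment> \<open>Near \<open>(p, p, p)\<close> the outer orbits are on the same side of
    \<open>z\<close>; from then on the common rule \<open>\<phi>\<close> keeps them
    together.\<close>
  have "\<exists>n\<ge>N. ((f ^^ n) x < z) = ((f ^^ n) w < z)"
  proof (cases "p < z")
    case True
    have "\<exists>\<^sub>F n in sequentially. joint f x y w n \<in> {..<z} \<times> UNIV \<times> {..<z}"
      by (rule cluster_frequently[OF p]) (use True in \<open>auto intro!: open_Times\<close>)
    then have "\<exists>n\<ge>N. joint f x y w n \<in> {..<z} \<times> UNIV \<times> {..<z}"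
      unfolding frequently_sequentially by (rule spec)
    then show ?thesis by (auto simp: joint_def)
  next
    case False
    have "\<exists>\<^sub>F n in sequentially. joint f x y w n \<in> {z<..} \<times> UNIV \<times> {z<..}"
      by (rule cluster_frequently[OF p]) (use False \<open>p \<noteq> z\<close> in \<open>auto intro!: open_Times\<close>)
    then have "\<exists>n\<ge>N. joint f x y w n \<in> {z<..} \<times> UNIV \<times> {z<..}"
      unfolding frequently_sequentially by (rule spec)
    then show ?thesis by (force simp: joint_def)
  qed
  then obtain m where m: "m \<ge> N" "((f ^^ m) x < z) = ((f ^^ m) w < z)" by blast
  have sync: "((f ^^ n) x < z) = ((f ^^ n) w < z)" if "n \<ge> m" for n
    using that
  proof (induction n rule: dec_induct)
    case (step n)
    then show ?case using N[of n] m by simp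
  qed (use m in simp)
  have "a \<noteq> z" "c \<noteq> z" using om zx zw by auto
  \<comment> \<open>Otherwise the outer orbits would be on opposite sides of \<open>z\<close>
    whenever the triple is near \<open>(a, b, c)\<close>.\<close>
  have "\<not> (a < z \<and> z < c)"
  proof
    assume "a < z \<and> z < c"
    then have "\<exists>\<^sub>F n in sequentially. joint f x y w n \<in> {..<z} \<times> UNIV \<times> {z<..}"
      by (intro cluster_frequently[OF abc(1)]) (auto intro!: open_Times)
    then have "\<exists>n\<ge>m. joint f x y w n \<in> {..<z} \<times> UNIV \<times> {z<..}"
      unfolding frequently_sequentially by (rule spec)
    then show False using sync by (force simp: joint_def)
  qed
  then consider "z < a" | "c < z" using \<open>a \<noteq> z\<close> \<open>c \<noteq> z\<close> by force
  \<comment> \<open>The common limit point is \<open>p\<close> or \<open>f p\<close>: if neither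
    were on the side of \<open>a\<close> and \<open>c\<close>, an outer orbit would eventually
    remain on the other side, against its limit point \<open>a\<close> or \<open>c\<close>.\<close>
  then have "\<exists>p'. p' \<in> omega_limit f x \<and> p' \<in> omega_limit f w \<and> (z < a \<and> z < p' \<or> c < z \<and> p' < z)"
  proof cases
    case 1
    have "z < p \<or> z < f p"
    proof (rule ccontr)
      assume "\<not> ?thesis"
      then have "p < z" "f p < z" using \<open>p \<noteq> z\<close> omega_limit_image[OF omp(1)] zx by (auto simp: less_le)
      then have "\<forall>\<^sub>F n in sequentially. (f ^^ n) x < z" using eventually_left[OF q(3) zx omp(1)] by blast
      moreover have "\<exists>\<^sub>F n in sequentially. (f ^^ n) x \<in> {z<..}"
        by (rule omega_limit_frequently[OF om(1)]) (use 1 in auto)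
      ultimately have "\<exists>\<^sub>F n in sequentially. (f ^^ n) x \<in> {z<..} \<and> (f ^^ n) x < z"
        by (rule frequently_eventually_frequently[rotated])
      then show False using frequently_ex by fastforce
    qed
    then show ?thesis using 1 omp omega_limit_image by blast
  next
    case 2
    have "p < z \<or> f p < z"
    proof (rule ccontr)
      assume "\<not> ?thesis"
      then have "z < p" "z < f p" using \<open>p \<noteq> z\<close> omega_limit_image[OF omp(1)] zx by (auto simp: less_le)
      then have "\<forall>\<^sub>F n in sequentially. z < (f ^^ n) w" using eventually_right[OF q(3) zw omp(3)] by blast
      moreover have "\<exists>\<^sub>F n in sequentially. (f ^^ n) w \<in> {..<z}"
        by (rule omega_limit_frequently[OF om(3)]) (use 2 in auto)
      ultimately have "\<exists>\<^sub>F n in sequentially. (f ^^ n) w \<in> {..<z} \<and> z < (f ^^ n) w"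
        by (rule frequently_eventually_frequently[rotated])
      then show False using frequently_ex by fastforce
    qed
    then show ?thesis using 2 omp omega_limit_image by blast
  qed
  then obtain p' where p': "p' \<in> omega_limit f x" "p' \<in> omega_limit f w"
    "z < a \<and> z < p' \<or> c < z \<and> p' < z" by blast
  have "p' \<noteq> q" using omega_limit_preimage_fixed[OF p'(1) q(3), of k] q(4) zx p'(1) by auto
  \<comment> \<open>The point \<open>p'\<close> is paired with the outer limit beyond
    \<open>q\<close>: with \<open>c\<close> in the limit set of \<open>w\<close>, or with
    \<open>a\<close> in that of \<open>x\<close>.\<close>
  then consider "p' < q" | "q < p'" by force
  then show False
  proof cases
    case 1
    then show False using omega_limit_homoclinic[OF q(3) p'(2) om(3) 1 q(2) _ q(4)] p'(3) by auto
  next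
    case 2
    then show False using omega_limit_homoclinic[OF q(3) om(1) p'(1) q(1) 2 _ q(4)] p'(3) by auto
  qed
qed

text \<open>Passing to the power given by a return time of \<open>y\<close> to \<open>(a, c)\<close> makes that interval meet its image.\<close>

lemma no_ordered_triple:
  assumes abc: "cluster (joint f x y w) (a, b, c)" "a < b" "b < c"
    and p: "cluster (joint f x y w) (p, p, p)"
  shows False
proof -
  have freq: "\<exists>\<^sub>F n in sequentially. (f ^^ n) y \<in> {a<..<c}"
    by (rule omega_limit_frequently[OF joint_cluster_omega_limit(2)[OF abc(1)]]) (use abc in auto)
  then obtain i where i: "(f ^^ i) y \<in> {a<..<c}" using frequently_ex by blast
  obtain j where j: "j \<ge> Suc i" "(f ^^ j) y \<in> {a<..<c}"
    using freq unfolding frequently_sequentially by blast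
  define r where "r = j - i"
  define g where "g = f ^^ r"
  have r: "r > 0" using j by (simp add: r_def)
  have "g ((f ^^ i) y) = (f ^^ j) y"
    using j(1) by (simp add: g_def r_def flip: funpow_add[THEN fun_cong, unfolded o_apply])
  then have t: "(f ^^ i) y \<in> {a<..<c}" "g ((f ^^ i) y) \<in> {a<..<c}" using i j by auto
  obtain s where s: "s < r" "cluster (\<lambda>n. joint f x y w (s + r * n)) (a, b, c)"
    using cluster_residue[OF abc(1) r] by blast
  obtain s' where s': "s' < r" "cluster (\<lambda>n. joint f x y w (s' + r * n)) (p, p, p)"
    using cluster_residue[OF p r] by blast
  have g: "(g ^^ n) ((f ^^ s) u) = (f ^^ (s + r * n)) u" for n u
    unfolding g_def funpow_mult by (simp add: add.commute flip: funpow_add[THEN fun_cong, unfolded o_apply])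
  then have jg: "joint g ((f ^^ s) x) ((f ^^ s) y) ((f ^^ s) w) = (\<lambda>n. joint f x y w (s + r * n))"
    by (auto simp: joint_def)
  \<comment> \<open>Chosen so that \<open>k\<close> steps carry time \<open>s' + r * n\<close> to
    \<open>s + r * (n + 1)\<close>. Continuity then gives a diagonal cluster point along the residue
    class that accumulates at \<open>(a, b, c)\<close>.\<close>
  define k where "k = s + r - s'"
  define H where "H t = ((f ^^ k) (fst t), (f ^^ k) (fst (snd t)), (f ^^ k) (snd (snd t)))" for t
  have cf: "continuous_on UNIV (f ^^ k)" by (rule continuous_on_funpow)
  have "continuous_on UNIV H" unfolding H_def
    by (intro continuous_intros continuous_on_compose2[OF cf]) auto
  then have "isCont H (p, p, p)" by (simp add: continuous_on_eq_continuous_at)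
  then have "cluster (\<lambda>n. H (joint f x y w (s' + r * n))) (H (p, p, p))" by (rule cluster_map[OF s'(2)])
  moreover have "H (joint f x y w (s' + r * n)) = joint f x y w (s + r * (n + 1))" for n
  proof -
    have "k + (s' + r * n) = s + r * (n + 1)" using s'(1) by (simp add: k_def)
    then have "(f ^^ k) ((f ^^ (s' + r * n)) u) = (f ^^ (s + r * (n + 1))) u" for u
      by (metis funpow_add o_apply)
    then show ?thesis by (simp add: H_def joint_def)
  qed
  ultimately have "cluster (\<lambda>n. joint f x y w (s + r * (n + 1))) (H (p, p, p))" by simp
  then have pp: "cluster (\<lambda>n. joint f x y w (s + r * n)) ((f ^^ k) p, (f ^^ k) p, (f ^^ k) p)"
    using cluster_shift[of "\<lambda>n. joint f x y w (s + r * n)" 1] unfolding H_def by simp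
  show False
    by (rule no_horseshoe.no_ordered_triple_returning[OF no_horseshoe_funpow[OF r, folded g_def]
          s(2)[folded jg] abc(2,3) pp[folded jg] t])
qed

text \<open>Two coordinate transpositions reach all six orders and leave the diagonal cluster point
  unchanged.\<close>

lemma no_distinct_triple:
  assumes abc: "cluster (joint f x y w) (a, b, c)" "a \<noteq> b" "b \<noteq> c" "a \<noteq> c"
    and p: "cluster (joint f x y w) (p, p, p)"
  shows False
proof -
  have swap1: "cluster (joint f y x w) (b, a, c)" if "cluster (joint f x y w) (a, b, c)" for x y w a b c
    using cluster_map[OF that, of "\<lambda>t. (fst (snd t), fst t, snd (snd t))"] by (simp add: joint_def[abs_def])
  have swap2: "cluster (joint f x w y) (a, c, b)" if "cluster (joint f x y w) (a, b, c)" for x y w a b c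
    using cluster_map[OF that, of "\<lambda>t. (fst t, snd (snd t), fst (snd t))"] by (simp add: joint_def[abs_def])
  note abc1 = swap1[OF abc(1)] and p1 = swap1[OF p]
  note abc2 = swap2[OF abc(1)] and p2 = swap2[OF p]
  consider "a < b" "b < c" | "a < c" "c < b" | "b < a" "a < c" | "b < c" "c < a" | "c < a" "a < b" | "c < b" "b < a"
    using abc(2-4) by linarith
  then show False
  proof cases
    case 1 then show ?thesis using no_ordered_triple[OF abc(1) _ _ p] by blast
  next
    case 2 then show ?thesis using no_ordered_triple[OF abc2 _ _ p2] by blast
  next
    case 3 then show ?thesis using no_ordered_triple[OF abc1 _ _ p1] by blast
  next
    case 4 then show ?thesis using no_ordered_triple[OF swap2[OF abc1] _ _ swap2[OF p1]] by blast
  next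
    case 5 then show ?thesis using no_ordered_triple[OF swap1[OF abc2] _ _ swap1[OF p2]] by blast
  next
    case 6 then show ?thesis
      using no_ordered_triple[OF swap1[OF swap2[OF abc1]] _ _ swap1[OF swap2[OF p1]]] by blast
  qed
qed

text \<open>Compactness turns the two frequency conditions into cluster points of the joint orbit,
  one on the diagonal and one with distinct coordinates.\<close>

lemma proximal_separated_triple_False:
  assumes near: "\<And>e. e > 0 \<Longrightarrow> \<exists>\<^sub>F n in sequentially. \<bar>(f ^^ n) x - (f ^^ n) y\<bar> < e \<and>
      \<bar>(f ^^ n) x - (f ^^ n) w\<bar> < e \<and> \<bar>(f ^^ n) y - (f ^^ n) w\<bar> < e"
    and far: "e > 0" "\<exists>\<^sub>F n in sequentially. e < \<bar>(f ^^ n) x - (f ^^ n) y\<bar> \<and>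
      e < \<bar>(f ^^ n) x - (f ^^ n) w\<bar> \<and> e < \<bar>(f ^^ n) y - (f ^^ n) w\<bar>"
  shows False
proof -
  define Q where "Q = {-M..M} \<times> {-M..M} \<times> {-M..M}"
  have Q: "compact Q" unfolding Q_def by (intro compact_Times) auto
  have inQ: "\<forall>\<^sub>F n in sequentially. joint f x y w n \<in> Q"
    using orbit_bounded by (intro eventually_sequentiallyI[of 1]) (auto simp: joint_def Q_def Suc_le_eq)
  have limit: "\<exists>l\<in>Q \<inter> C. cluster (joint f x y w) l"
    if "closed C" "\<exists>\<^sub>F n in sequentially. joint f x y w n \<in> C" for C
  proof (rule frequently_compact_cluster)
    show "compact (Q \<inter> C)" using Q that(1) by (rule compact_Int_closed)
    have "\<exists>\<^sub>F n in sequentially. joint f x y w n \<in> C \<and> joint f x y w n \<in> Q"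
      using that(2) inQ by (rule frequently_eventually_frequently)
    then show "\<exists>\<^sub>F n in sequentially. joint f x y w n \<in> Q \<inter> C" by (rule frequently_elim1) auto
  qed
  \<comment> \<open>The diameter of a triple; its minimum over the compact set of cluster points is
    zero, which gives one point on the diagonal.\<close>
  define D where "D t = max \<bar>fst t - fst (snd t)\<bar> (max \<bar>fst t - snd (snd t)\<bar> \<bar>fst (snd t) - snd (snd t)\<bar>)"
    for t :: "real \<times> real \<times> real"
  have D: "continuous_on A D" for A unfolding D_def by (intro continuous_intros)
  define L where "L = Q \<inter> {l. cluster (joint f x y w) l}"
  have small: "\<exists>l\<in>L. D l \<le> e" if "e > 0" for e
  proof -
    have "closed {l. D l \<le> e}" using D by (intro closed_Collect_le continuous_intros)
    moreover have "\<exists>\<^sub>F n in sequentially. joint f x y w n \<in> {l. D l \<le> e}"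
      using near[OF that] by (rule frequently_elim1) (auto simp: joint_def D_def)
    ultimately obtain l where "l \<in> Q \<inter> {l. D l \<le> e}" "cluster (joint f x y w) l" using limit by metis
    then show ?thesis by (auto simp: L_def)
  qed
  have "compact L" unfolding L_def using Q closed_cluster by (rule compact_Int_closed)
  moreover have "L \<noteq> {}" using small[of 1] by auto
  ultimately obtain l where l: "l \<in> L" "\<And>v. v \<in> L \<Longrightarrow> D l \<le> D v"
    using continuous_attains_inf[OF _ _ D] by metis
  have "D l \<le> 0"
  proof (rule field_le_epsilon)
    fix e :: real assume "e > 0"
    then obtain v where "v \<in> L" "D v \<le> e" using small by blast
    then show "D l \<le> 0 + e" using l(2)[of v] by simp
  qed
  then have "fst l = fst (snd l)" "fst l = snd (snd l)" by (auto simp: D_def)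
  then have "l = (fst l, fst l, fst l)" by (metis prod.collapse)
  then have p: "cluster (joint f x y w) (fst l, fst l, fst l)" using l(1) by (simp add: L_def)
  define C where "C = {t::real\<times>real\<times>real. e \<le> \<bar>fst t - fst (snd t)\<bar> \<and> e \<le> \<bar>fst t - snd (snd t)\<bar> \<and>
      e \<le> \<bar>fst (snd t) - snd (snd t)\<bar>}"
  have "closed C" unfolding C_def by (intro closed_Collect_conj closed_Collect_le continuous_intros)
  moreover have "\<exists>\<^sub>F n in sequentially. joint f x y w n \<in> C"
    using far(2) by (rule frequently_elim1) (auto simp: joint_def C_def)
  ultimately obtain v where v: "v \<in> Q \<inter> C" "cluster (joint f x y w) v" using limit by metis
  obtain a b c where abc: "v = (a, b, c)" by (cases v)
  show False
    by (rule no_distinct_triple[OF v(2)[unfolded abc] _ _ _ p]) (use v(1) abc far(1) in \<open>auto simp: C_def\<close>)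
qed

end

section \<open>Horseshoes and entropy\<close>

lemma interval_map_funpow:
  assumes "interval_map f"
  shows "continuous_on {0..1} (f ^^ k)" "x \<in> {0..1} \<Longrightarrow> (f ^^ k) x \<in> {0..1}"
proof -
  have "continuous_on {0..1} (f ^^ k) \<and> (f ^^ k) ` {0..1} \<subseteq> {0..1}"
  proof (induction k)
    case (Suc k)
    then have "continuous_on {0..1} (\<lambda>x. f ((f ^^ k) x))"
      using continuous_on_compose2[of "{0..1}" f "{0..1}" "f ^^ k"] assms
      unfolding interval_map_def by blast
    moreover have "(\<lambda>x. f ((f ^^ k) x)) ` {0..1} \<subseteq> {0..1}"
      using Suc assms unfolding interval_map_def by (simp add: image_subset_iff)
    ultimately show ?case by (simp add: o_def)
  qed (auto intro: continuous_intros)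
  then show "continuous_on {0..1} (f ^^ k)" "x \<in> {0..1} \<Longrightarrow> (f ^^ k) x \<in> {0..1}" by blast+
qed

lemma interval_map_equicontinuous:
  assumes "interval_map f" "e > 0"
  shows "\<exists>d>0. \<forall>k<n. \<forall>x\<in>{0..1}. \<forall>y\<in>{0..1}. \<bar>x - y\<bar> < d \<longrightarrow> \<bar>(f ^^ k) x - (f ^^ k) y\<bar> \<le> e"
proof (induction n)
  case 0
  show ?case by (auto intro: exI[of _ 1])
next
  case (Suc n)
  then obtain d where d: "d > 0"
    "\<And>k x y. k < n \<Longrightarrow> x \<in> {0..1} \<Longrightarrow> y \<in> {0..1} \<Longrightarrow> \<bar>x - y\<bar> < d \<Longrightarrow> \<bar>(f ^^ k) x - (f ^^ k) y\<bar> \<le> e"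
    by blast
  have "uniformly_continuous_on {0..1} (f ^^ n)"
    using interval_map_funpow[OF assms(1)] by (intro compact_uniformly_continuous) auto
  then obtain d' where d': "d' > 0"
    "\<And>x y. x \<in> {0..1} \<Longrightarrow> y \<in> {0..1} \<Longrightarrow> \<bar>x - y\<bar> < d' \<Longrightarrow> \<bar>(f ^^ n) x - (f ^^ n) y\<bar> < e"
    using assms(2) unfolding uniformly_continuous_on_def dist_real_def by blast
  show ?case
  proof (intro exI[of _ "min d d'"] conjI allI impI ballI)
    fix k x y assume *: "k < Suc n" "x \<in> {0..1::real}" "y \<in> {0..1::real}" "\<bar>x - y\<bar> < min d d'"
    then show "\<bar>(f ^^ k) x - (f ^^ k) y\<bar> \<le> e"
      using d(2)[of k x y] d'(2)[of x y] by (cases "k = n") auto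
  qed (use d d' in auto)
qed

text \<open>A supremum of natural numbers dominates its members only if they are bounded. Two points
  in one cell of width \<open>d\<close>, with \<open>d\<close> from equicontinuity of the first
  \<open>n\<close> iterates, are not separated, so the number of cells is a bound.\<close>

lemma separated_card_le_sep_num:
  assumes "interval_map f" "e > 0" "separated_set f n e E"
  shows "card E \<le> sep_num f n e"
proof -
  obtain d where d: "d > 0" "\<And>k x y. k < n \<Longrightarrow> x \<in> {0..1} \<Longrightarrow> y \<in> {0..1} \<Longrightarrow> \<bar>x - y\<bar> < d \<Longrightarrow>
      \<bar>(f ^^ k) x - (f ^^ k) y\<bar> \<le> e"
    using interval_map_equicontinuous[OF assms(1,2), of n] by blast
  have bound: "card S \<le> card {0..\<lfloor>1 / d\<rfloor>}" if S: "separated_set f n e S" for S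
  proof (rule card_inj_on_le[of "\<lambda>x. \<lfloor>x / d\<rfloor>"])
    show "inj_on (\<lambda>x. \<lfloor>x / d\<rfloor>) S"
    proof (rule inj_onI, rule ccontr)
      fix x y assume xy: "x \<in> S" "y \<in> S" "\<lfloor>x / d\<rfloor> = \<lfloor>y / d\<rfloor>" "x \<noteq> y"
      then obtain k where k: "k < n" "\<bar>(f ^^ k) x - (f ^^ k) y\<bar> > e"
        using S unfolding separated_set_def by blast
      have "\<bar>x / d - y / d\<bar> < 1" using xy(3) by linarith
      then have "\<bar>x - y\<bar> < d" using d(1) by (simp add: field_simps flip: diff_divide_distrib)
      moreover have "x \<in> {0..1}" "y \<in> {0..1}" using xy S by (auto simp: separated_set_def)
      ultimately show False using d(2)[OF k(1), of x y] k(2) by auto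
    qed
    show "(\<lambda>x. \<lfloor>x / d\<rfloor>) ` S \<subseteq> {0..\<lfloor>1 / d\<rfloor>}"
    proof
      fix i assume "i \<in> (\<lambda>x. \<lfloor>x / d\<rfloor>) ` S"
      then obtain x where x: "x \<in> S" "i = \<lfloor>x / d\<rfloor>" by blast
      then have "x \<in> {0..1}" using S by (auto simp: separated_set_def)
      then have "0 \<le> x / d" "x / d \<le> 1 / d" using d(1) by (auto intro: divide_right_mono)
      then show "i \<in> {0..\<lfloor>1 / d\<rfloor>}" unfolding x(2) by (simp add: floor_mono)
    qed
  qed simp
  show ?thesis unfolding sep_num_def
  proof (rule cSup_upper)
    show "card E \<in> {card E |E. separated_set f n e E}" using assms(3) by blast
    show "bdd_above {card E |E. separated_set f n e E}"
      unfolding bdd_above_def using bound by blast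
  qed
qed

text \<open>Words grow at the front: a point following \<open>ws\<close> lies in
  \<open>[a, d]\<close>, so it has a preimage in the interval named by the new first letter.\<close>

lemma horseshoe_itinerary:
  assumes "{a..d} \<subseteq> g ` {a..b}" "{a..d} \<subseteq> g ` {c..d}" "a \<le> b" "b < c" "c \<le> (d::real)"
  shows "\<exists>x\<in>{a..d}. \<forall>i<length ws. (g ^^ i) x \<in> (if ws ! i then {a..b} else {c..d})"
proof (induction ws)
  case Nil
  show ?case using assms by auto
next
  case (Cons v ws)
  then obtain x where x: "x \<in> {a..d}" "\<And>i. i < length ws \<Longrightarrow> (g ^^ i) x \<in> (if ws ! i then {a..b} else {c..d})"
    by blast
  then obtain x' where x': "x' \<in> (if v then {a..b} else {c..d})" "g x' = x"
    using assms(1,2) by (cases v) (auto; blast)+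
  have "(g ^^ i) x' \<in> (if (v # ws) ! i then {a..b} else {c..d})" if "i < length (v # ws)" for i
    using that x x' by (cases i) (auto simp: funpow_swap1)
  moreover have "x' \<in> {a..d}" using x'(1) assms by (cases v) auto
  ultimately show ?case by blast
qed

text \<open>One point is taken for each binary word of length \<open>n\<close>. Where two words
  differ, at position \<open>i\<close>, the iterates at time \<open>m * i\<close> lie in different
  intervals, at least \<open>c - b\<close> apart; halving the gap makes the separation
  strict.\<close>

lemma horseshoe_separated_set:
  assumes hs: "{a..d} \<subseteq> (f ^^ m) ` {a..b}" "{a..d} \<subseteq> (f ^^ m) ` {c..d}" "a \<le> b" "b < c" "c \<le> d"
    and sub: "{a..d} \<subseteq> {0..1}" and m: "m > 0"
  shows "\<exists>E. separated_set f (m * n) ((c - b) / 2) E \<and> card E = 2 ^ n"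
proof -
  define W where "W = {ws :: bool list. length ws = n}"
  define g where "g = f ^^ m"
  obtain P where P: "\<And>ws. P ws \<in> {a..d}"
    "\<And>ws i. i < length ws \<Longrightarrow> (g ^^ i) (P ws) \<in> (if ws ! i then {a..b} else {c..d})"
    using horseshoe_itinerary[OF hs[folded g_def]] by metis
  have sep: "\<exists>i<n. \<bar>(g ^^ i) (P v) - (g ^^ i) (P w)\<bar> > (c - b) / 2" if vw: "v \<in> W" "w \<in> W" "v \<noteq> w" for v w
  proof -
    obtain i where i: "i < n" "v ! i \<noteq> w ! i"
      using vw nth_equalityI[of v w] by (auto simp: W_def)
    then have "\<bar>(g ^^ i) (P v) - (g ^^ i) (P w)\<bar> \<ge> c - b"
      using P(2)[of i v] P(2)[of i w] vw by (cases "v ! i"; cases "w ! i") (auto simp: W_def)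
    then show ?thesis using i(1) hs(4) by (intro exI[of _ i]) auto
  qed
  have inj: "inj_on P W"
    by (rule inj_onI, rule ccontr) (use sep hs(4) in force)
  have cardW: "card W = 2 ^ n"
    using card_lists_length_eq[of "UNIV :: bool set" n] by (simp add: W_def)
  then have "finite W" by (metis card.infinite power_not_zero zero_neq_numeral)
  have "separated_set f (m * n) ((c - b) / 2) (P ` W)"
    unfolding separated_set_def
  proof (intro conjI ballI impI)
    show "P ` W \<subseteq> {0..1}" using P(1) sub by blast
    show "finite (P ` W)" using \<open>finite W\<close> by simp
    fix x y assume "x \<in> P ` W" "y \<in> P ` W" "x \<noteq> y"
    then obtain v w where vw: "x = P v" "y = P w" "v \<in> W" "w \<in> W" "v \<noteq> w" by blast
    then obtain i where i: "i < n" "\<bar>(g ^^ i) x - (g ^^ i) y\<bar> > (c - b) / 2" using sep by blast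
    have "m * i < m * n" using i m by simp
    then show "\<exists>k<m * n. (c - b) / 2 < \<bar>(f ^^ k) x - (f ^^ k) y\<bar>"
      using i(2) by (intro exI[of _ "m * i"]) (simp add: g_def funpow_mult mult.commute)
  qed
  then show ?thesis using inj cardW by (auto simp: card_image)
qed

text \<open>At the fixed scale \<open>e\<close>, the \<open>2 ^ n\<close> separated points for orbit
  length \<open>m * n\<close> give rate at least \<open>ln 2 / m\<close> along multiples of
  \<open>m\<close>, enough for the limsup.\<close>

lemma horseshoe_entropy_pos:
  assumes f: "interval_map f"
    and hs: "{a..d} \<subseteq> (f ^^ m) ` {a..b}" "{a..d} \<subseteq> (f ^^ m) ` {c..d}" "a \<le> b" "b < c" "c \<le> d"
    and sub: "{a..d} \<subseteq> {0..1}" and m: "m > 0"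
  shows "topological_entropy f > 0"
proof -
  define e where "e = (c - b) / 2"
  have e: "e > 0" using hs by (simp add: e_def)
  define h where "h n = ereal (ln (real (sep_num f n e)) / real n)" for n
  have "limsup h \<ge> ereal (ln 2 / real m)"
  proof (rule ccontr)
    assume "\<not> ?thesis"
    then have "limsup h < ereal (ln 2 / real m)" by simp
    then have "\<forall>\<^sub>F n in sequentially. h n < ereal (ln 2 / real m)" by (rule Limsup_lessD)
    then obtain N where N: "\<And>n. n \<ge> N \<Longrightarrow> h n < ereal (ln 2 / real m)"
      unfolding eventually_sequentially by blast
    define n where "n = Suc N"
    have "m * n \<ge> N" using m by (cases m) (auto simp: n_def)
    obtain E where E: "separated_set f (m * n) e E" "card E = 2 ^ n"
      using horseshoe_separated_set[OF hs sub m] unfolding e_def by blast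
    have "2 ^ n \<le> sep_num f (m * n) e" using separated_card_le_sep_num[OF f e E(1)] E(2) by simp
    then have "real (2 ^ n) \<le> real (sep_num f (m * n) e)" by (rule of_nat_mono)
    then have "ln (real (2 ^ n)) \<le> ln (real (sep_num f (m * n) e))" by (intro ln_mono) auto
    then have "real n * ln 2 \<le> ln (real (sep_num f (m * n) e))" by (simp add: ln_realpow)
    then have "real n * ln 2 / real (m * n) \<le> ln (real (sep_num f (m * n) e)) / real (m * n)"
      by (rule divide_right_mono) simp
    moreover have "real n * ln 2 / real (m * n) = ln 2 / real m"
    proof -
      have "real n \<noteq> 0" by (simp add: n_def)
      then show ?thesis by (simp add: mult.commute)
    qed
    ultimately have "ln 2 / real m \<le> ln (real (sep_num f (m * n) e)) / real (m * n)" by simp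
    then show False using N[OF \<open>m * n \<ge> N\<close>] by (simp add: h_def)
  qed
  moreover have "limsup h \<le> topological_entropy f"
    unfolding topological_entropy_def h_def using e by (intro SUP_upper) simp
  moreover have "ereal (ln 2 / real m) > 0" using m by simp
  ultimately show ?thesis by (meson less_le_trans)
qed

section \<open>Extension to the line and conclusion\<close>

lemma funpow_clamp:
  assumes "interval_map f" "x \<in> {0..1}"
  shows "((\<lambda>x. f (max 0 (min 1 x))) ^^ k) x = (f ^^ k) x"
proof (induction k)
  case (Suc k)
  then show ?case using interval_map_funpow(2)[OF assms, of k] by simp
qed simp

text \<open>Clamping the argument extends \<open>f\<close> to the line without changing orbits in
  the unit interval. The hull of a horseshoe of the extension is covered by its values, so it lies
  in \<open>[0, 1]\<close> and the horseshoe belongs to \<open>f\<close>, forcing positive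
  entropy.\<close>

lemma zero_entropy_no_horseshoe:
  assumes f: "interval_map f" "topological_entropy f = 0"
  shows "no_horseshoe (\<lambda>x. f (max 0 (min 1 x))) 1"
proof -
  define F where "F x = f (max 0 (min 1 x))" for x
  have range: "F x \<in> {0..1}" for x
  proof -
    have "max 0 (min 1 x) \<in> {0..1::real}" by auto
    then show ?thesis using f(1) unfolding F_def interval_map_def by blast
  qed
  have iter: "(F ^^ k) x = (f ^^ k) x" if "x \<in> {0..1}" for k x
    using funpow_clamp[OF f(1) that] by (simp add: F_def[abs_def])
  have "no_horseshoe F 1"
  proof
    show "continuous_on UNIV F" unfolding F_def
      using f(1) unfolding interval_map_def
      by (intro continuous_on_compose2[of "{0..1}" f UNIV "\<lambda>x. max 0 (min 1 x)"] continuous_intros) auto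
    show "\<bar>F x\<bar> \<le> 1" for x using range[of x] by auto
    show "\<not> horseshoe F"
    proof
      assume "horseshoe F"
      then obtain m a b c d where *: "m > 0" "a \<le> b" "b < c" "c \<le> d"
        "{a..d} \<subseteq> (F ^^ m) ` {a..b}" "{a..d} \<subseteq> (F ^^ m) ` {c..d}"
        unfolding horseshoe_def by blast
      have "(F ^^ m) x \<in> {0..1}" for x using range \<open>m > 0\<close> by (cases m) auto
      then have sub: "{a..d} \<subseteq> {0..1}" using *(5) by blast
      then have "{a..b} \<subseteq> {0..1}" "{c..d} \<subseteq> {0..1}" using * by auto
      then have eq: "(F ^^ m) ` {a..b} = (f ^^ m) ` {a..b}" "(F ^^ m) ` {c..d} = (f ^^ m) ` {c..d}"
        using iter by (auto intro!: image_cong)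
      show False
        using horseshoe_entropy_pos[OF f(1) *(5,6)[unfolded eq] *(2-4) sub *(1)] f(2) by simp
    qed
  qed
  then show ?thesis by (simp add: F_def[abs_def])
qed

lemma pair_differences_three:
  fixes g :: "nat \<Rightarrow> nat \<Rightarrow> real"
  shows "{g i j |i j. i < j \<and> j < 3} = {g 0 1, g 0 2, g 1 2}"
proof -
  have "i < j \<and> j < 3 \<longleftrightarrow> (i, j) \<in> {(0, 1), (0, 2), (1, 2)}" for i j :: nat by auto
  then show ?thesis by auto
qed

theorem mainTheorem14:
  fixes f :: "real \<Rightarrow> real"
  assumes "interval_map f"
    and "topological_entropy f = 0"
  shows "\<not> (\<exists>x. scrambled f 3 x)"
proof
  assume "\<exists>x. scrambled f 3 x"
  then obtain x where x: "scrambled f 3 x" by blast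
  define F where "F t = f (max 0 (min 1 t))" for t
  interpret no_horseshoe F 1
    using zero_entropy_no_horseshoe[OF assms] by (simp add: F_def[abs_def])
  have x01: "x i \<in> {0..1}" if "i < 3" for i using x that by (simp add: scrambled_def)
  have iter: "(f ^^ k) t = (F ^^ k) t" if "t \<in> {0..1}" for k t
    using funpow_clamp[OF assms(1) that] by (simp add: F_def[abs_def])
  define S where "S k = {\<bar>(F ^^ k) (x 0) - (F ^^ k) (x 1)\<bar>, \<bar>(F ^^ k) (x 0) - (F ^^ k) (x 2)\<bar>,
    \<bar>(F ^^ k) (x 1) - (F ^^ k) (x 2)\<bar>}" for k
  have S: "{\<bar>(f ^^ k) (x i) - (f ^^ k) (x j)\<bar> |i j. i < j \<and> j < 3} = S k" for k
    unfolding pair_differences_three S_def using iter x01 by simp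
  have lim: "liminf (\<lambda>k. ereal (Max (S k))) = 0" "limsup (\<lambda>k. ereal (Min (S k))) > 0"
    using x unfolding scrambled_def S by auto
  have fin: "finite (S k)" "S k \<noteq> {}" for k by (auto simp: S_def)
  have near: "\<exists>\<^sub>F k in sequentially. Max (S k) < e" if "e > 0" for e
  proof (rule ccontr)
    assume "\<not> ?thesis"
    then have "\<forall>\<^sub>F k in sequentially. ereal e \<le> ereal (Max (S k))" by (simp add: frequently_def not_less)
    then have "ereal e \<le> liminf (\<lambda>k. ereal (Max (S k)))" by (rule Liminf_bounded)
    then show False using lim(1) that by simp
  qed
  \<comment> \<open>The limsup is an extended real; a real threshold strictly between 0 and it is a
    uniform separation attained infinitely often.\<close>
  obtain e where e: "0 < ereal e" "ereal e < limsup (\<lambda>k. ereal (Min (S k)))"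
    using ereal_dense2[OF lim(2)] by auto
  have far: "\<exists>\<^sub>F k in sequentially. e < Min (S k)"
  proof (rule ccontr)
    assume "\<not> ?thesis"
    then have "\<forall>\<^sub>F k in sequentially. ereal (Min (S k)) \<le> ereal e" by (simp add: frequently_def not_less)
    then have "limsup (\<lambda>k. ereal (Min (S k))) \<le> ereal e" by (rule Limsup_bounded)
    then show False using e(2) by simp
  qed
  show False
  proof (rule proximal_separated_triple_False[of "x 0" "x 1" "x 2" e])
    show "\<exists>\<^sub>F n in sequentially. \<bar>(F ^^ n) (x 0) - (F ^^ n) (x 1)\<bar> < e' \<and>
        \<bar>(F ^^ n) (x 0) - (F ^^ n) (x 2)\<bar> < e' \<and> \<bar>(F ^^ n) (x 1) - (F ^^ n) (x 2)\<bar> < e'" if "e' > 0" for e'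
      using near[OF that] by (rule frequently_elim1) (use fin in \<open>simp add: Max_less_iff, simp add: S_def\<close>)
    show "0 < e" using e(1) by simp
    show "\<exists>\<^sub>F n in sequentially. e < \<bar>(F ^^ n) (x 0) - (F ^^ n) (x 1)\<bar> \<and>
        e < \<bar>(F ^^ n) (x 0) - (F ^^ n) (x 2)\<bar> \<and> e < \<bar>(F ^^ n) (x 1) - (F ^^ n) (x 2)\<bar>"
      using far by (rule frequently_elim1) (use fin in \<open>simp add: Min_gr_iff, simp add: S_def\<close>)
  qed
qed

end
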